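(* For any lattice $L$, one has $h^0(L)=\ln(\rho(L))$, $h^1(L)=\ln(\rho(L))+\ln(\mathrm{vol}(L))$, $h^k(L)=0$ for $k\ge2$, and $\chi(L)=-\ln(\mathrm{vol}(L))$, where $h^k(L)=\lim_{n\to\infty}h^k_\bullet(R_{L,n})$ and $\chi(L)=h^0(L)-h^1(L)$.
   Context: A lattice is a subgroup $L$ of a finite-dimensional real inner product space that is generated by a linearly independent set of vectors (equivalently, is discrete). A lattice homomorphism $f:L\to M$ is a group homomorphism with $\|f(x)\|\le\|x\|$ for all $x\in L$; its kernel is $\mathrm{Ker}(f)=\{x\in L:f(x)=0\}$ with the inherited inner product. A normal sublattice of $L$ is one of the form $K=L\cap V$, $V$ a subspace of $\mathrm{span}(L)$; the quotient lattice $L/K$ is the orthogonal projection of $L$ onto $\mathrm{span}(K)^\perp\subseteq\mathrm{span}(L)$. $L\otimes M$ is the subgroup of $\mathrm{span}(L)\otimes\mathrm{span}(M)$ generated by the $x\otimes y$ ($x\in L,y\in M$), where the tensor product of inner product spaces has $\langle v_1\otimes w_1,v_2\otimes w_2\rangle=\langle v_1,v_2\rangle\langle w_1,w_2\rangle$. If $L$ has basis $x_1,\ldots,x_d$ and $e_1,\ldots,e_d$ is an orthonormal basis of $\mathrm{span}(L)$, then $\mathrm{vol}(L)=|\det T|$ where $T$ is the operator on $\mathrm{span}(L)$ with $T(e_i)=x_i$ (independent of choices). $\rho(S)=\sum_{x\in S}e^{-\pi\|x\|^2}$ for a subset $S$ of an inner product space; $\ell(L)=\ln\rho(L)$; for a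 lattice homomorphism $f:L\to M$, $\mathrm{nul}(f)=\ell(\mathrm{Ker} f)$ and $\mathrm{rk}(f)=\ell(L)-\mathrm{nul}(f)$. For a chain complex $A:\ 0\xrightarrow{a_0}A_1\xrightarrow{a_1}A_2\xrightarrow{a_2}\cdots$ of lattices and lattice homomorphisms, $h^k_\bullet(A)=\mathrm{nul}(a_{k+1})-\mathrm{rk}(a_k)$ for $k\ge0$. For $n\in\{1,2,3,\ldots\}$, $P_n$ is the sublattice of $\mathbb R^2$ generated by $(\frac1n,0)$ and $(0,\sqrt{\frac1{n^2}-\frac1{n^4}})$. There is an isometric embedding $\mathbb Z\to P_n$, $1\mapsto(\frac1n,\sqrt{1-\frac1{n^2}})$, whose image is a normal sublattice; $P_n/\mathbb Z$ is the quotient lattice of $P_n$ by this image. For a lattice $L$, $R_{L,n}$ is the chain complex $0\to P_n\otimes L\to(P_n/\mathbb Z)\otimes L\to0\to0\to\cdots$, the map being the projection $P_n\to P_n/\mathbb Z$ tensored with $L$. The limit defining $h^k(L)$ exists for every $k\ge0$. *)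

theory Defs
  imports
    "HOL-Analysis.Analysis"
    "HOL-Computational_Algebra.Group_Closure"
    "Jordan_Normal_Form.Determinant"
begin

text \<open>Only matrices of variable size and their determinants are used from the matrix library;
  its other names and notations that clash with those of the analysis library are hidden.\<close>

hide_const (open) Matrix.orthogonal Matrix.mat Determinant.det
hide_type (open) Matrix.vec
no_notation Matrix.scalar_prod (infix "\<bullet>" 70)
no_notation Matrix.vec_index (infixl "$" 100)

section \<open>Tensor product of Euclidean spaces\<close>

text \<open>
  The tensor product of two finite-dimensional real inner product spaces is realised as the space
  of linear maps from the first to the second with the Hilbert--Schmidt inner product; the pure
  tensor of \<open>v\<close> and \<open>w\<close> is the rank-one map \<open>u \<mapsto> \<langle>v, u\<rangle> w\<close>.
  That this is a tensor product with the usual inner product is shown in the lemmas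
  \<open>bilinear_pure_tensor\<close>, \<open>inner_pure_tensor\<close>, \<open>span_pure_tensor\<close> and
  \<open>tensor_universal\<close> below.
\<close>

typedef (overloaded) ('a::euclidean_space, 'b::euclidean_space) tensor =
  "{T :: 'a \<Rightarrow> 'b. linear T}"
  morphisms tensor_apply Abs_tensor
  by (rule exI [of _ "\<lambda>_. 0"]) (simp add: linear_iff)

setup_lifting type_definition_tensor

lemma linear_tensor_apply: "linear (tensor_apply T)"
  using tensor_apply [of T] by simp

lemma tensor_eqI: "(\<And>u. tensor_apply S u = tensor_apply T u) \<Longrightarrow> S = T"
  by (simp add: fun_eq_iff flip: tensor_apply_inject)

instantiation tensor :: (euclidean_space, euclidean_space) real_vector
begin

lift_definition zero_tensor :: "('a, 'b) tensor" is "\<lambda>_. 0"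
  by (simp add: linear_iff)

lift_definition plus_tensor :: "('a, 'b) tensor \<Rightarrow> ('a, 'b) tensor \<Rightarrow> ('a, 'b) tensor"
  is "\<lambda>S T u. S u + T u"
  by (rule linear_compose_add)

lift_definition uminus_tensor :: "('a, 'b) tensor \<Rightarrow> ('a, 'b) tensor" is "\<lambda>T u. - T u"
  by (rule linear_compose_neg)

lift_definition minus_tensor :: "('a, 'b) tensor \<Rightarrow> ('a, 'b) tensor \<Rightarrow> ('a, 'b) tensor"
  is "\<lambda>S T u. S u - T u"
  by (rule linear_compose_sub)

lift_definition scaleR_tensor :: "real \<Rightarrow> ('a, 'b) tensor \<Rightarrow> ('a, 'b) tensor"
  is "\<lambda>c T u. c *\<^sub>R T u"
  by (rule linear_compose_scale_right)

instance
  by standard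
    (rule tensor_eqI, simp add: zero_tensor.rep_eq plus_tensor.rep_eq uminus_tensor.rep_eq
      minus_tensor.rep_eq scaleR_tensor.rep_eq scaleR_add_left scaleR_add_right ac_simps)+

end

instantiation tensor :: (euclidean_space, euclidean_space) real_inner
begin

lift_definition inner_tensor :: "('a, 'b) tensor \<Rightarrow> ('a, 'b) tensor \<Rightarrow> real"
  is "\<lambda>S T. \<Sum>b\<in>Basis. inner (S b) (T b)" .

definition norm_tensor :: "('a, 'b) tensor \<Rightarrow> real" where
  "norm_tensor T = sqrt (inner T T)"

definition sgn_tensor :: "('a, 'b) tensor \<Rightarrow> ('a, 'b) tensor" where
  "sgn_tensor T = T /\<^sub>R norm T"

definition dist_tensor :: "('a, 'b) tensor \<Rightarrow> ('a, 'b) tensor \<Rightarrow> real" where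
  "dist_tensor S T = norm (S - T)"

definition uniformity_tensor :: "(('a, 'b) tensor \<times> ('a, 'b) tensor) filter" where
  "uniformity_tensor = (INF e\<in>{0 <..}. principal {(S, T). dist S T < e})"

definition open_tensor :: "('a, 'b) tensor set \<Rightarrow> bool" where
  "open_tensor U \<longleftrightarrow> (\<forall>S\<in>U. eventually (\<lambda>(S', T). S' = S \<longrightarrow> T \<in> U) uniformity)"

instance
proof
  fix S T R :: "('a, 'b) tensor" and c :: real
  show "inner S T = inner T S"
    by (simp add: inner_tensor.rep_eq inner_commute)
  show "inner (S + T) R = inner S R + inner T R"
    by (simp add: inner_tensor.rep_eq plus_tensor.rep_eq inner_add_left sum.distrib)
  show "inner (c *\<^sub>R S) T = c * inner S T"
    by (simp add: inner_tensor.rep_eq scaleR_tensor.rep_eq sum_distrib_left)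
  show "0 \<le> inner T T"
    by (simp add: inner_tensor.rep_eq sum_nonneg)
  show "inner T T = 0 \<longleftrightarrow> T = 0"
  proof
    assume "inner T T = 0"
    then have *: "\<forall>b\<in>Basis. tensor_apply T b = 0"
      by (simp add: inner_tensor.rep_eq sum_nonneg_eq_0_iff)
    have "tensor_apply T = (\<lambda>_. 0)"
      by (rule linear_eq_stdbasis [OF linear_tensor_apply linear_zero]) (use * in simp)
    then show "T = 0"
      by (intro tensor_eqI) (simp add: zero_tensor.rep_eq)
  qed (simp add: inner_tensor.rep_eq zero_tensor.rep_eq)
qed (simp_all add: norm_tensor_def sgn_tensor_def dist_tensor_def uniformity_tensor_def
    open_tensor_def)

end

lift_definition pure_tensor :: "'a::euclidean_space \<Rightarrow> 'b::euclidean_space \<Rightarrow> ('a, 'b) tensor"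
  is "\<lambda>v w u. inner v u *\<^sub>R w"
  by (simp add: linear_iff inner_add_right scaleR_add_left)

lemma bilinear_pure_tensor: "bilinear pure_tensor"
  unfolding bilinear_def linear_iff
  by (intro conjI allI; rule tensor_eqI)
    (simp_all add: pure_tensor.rep_eq plus_tensor.rep_eq scaleR_tensor.rep_eq inner_add_left
      scaleR_add_left scaleR_add_right)

lemma inner_pure_tensor: "inner (pure_tensor v w) (pure_tensor v' w') = inner v v' * inner w w'"
proof -
  have "inner (pure_tensor v w) (pure_tensor v' w') =
        (\<Sum>b\<in>Basis. inner v b * inner v' b) * inner w w'"
    by (simp add: inner_tensor.rep_eq pure_tensor.rep_eq sum_distrib_left mult_ac)
  then show ?thesis
    by (simp add: euclidean_inner [of v v'])
qed

lemma inner_pure_tensor_right: "inner T (pure_tensor v w) = inner (tensor_apply T v) w"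
proof -
  interpret T: linear "tensor_apply T"
    by (rule linear_tensor_apply)
  have "tensor_apply T v = tensor_apply T (\<Sum>b\<in>Basis. inner v b *\<^sub>R b)"
    by (simp add: euclidean_representation)
  also have "\<dots> = (\<Sum>b\<in>Basis. inner v b *\<^sub>R tensor_apply T b)"
    by (simp add: T.sum T.scale)
  finally show ?thesis
    by (simp add: inner_tensor.rep_eq pure_tensor.rep_eq inner_sum_left)
qed

instantiation tensor :: (euclidean_space, euclidean_space) euclidean_space
begin

definition Basis_tensor :: "('a, 'b) tensor set" where
  "Basis_tensor = (\<lambda>(b, c). pure_tensor b c) ` (Basis \<times> Basis)"

instance
proof
  show "(Basis :: ('a, 'b) tensor set) \<noteq> {}" "finite (Basis :: ('a, 'b) tensor set)"
    by (auto simp: Basis_tensor_def)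
next
  fix S T :: "('a, 'b) tensor"
  assume "S \<in> Basis" "T \<in> Basis"
  then obtain b c b' c' where
    S: "S = pure_tensor b c" "b \<in> Basis" "c \<in> Basis" and
    T: "T = pure_tensor b' c'" "b' \<in> Basis" "c' \<in> Basis"
    by (auto simp: Basis_tensor_def)
  have *: "inner S T = (if b = b' \<and> c = c' then 1 else 0)"
    using S T by (auto simp: inner_pure_tensor inner_Basis)
  have "inner S S = 1"
    using S by (simp add: inner_pure_tensor)
  then have "S = T \<longleftrightarrow> b = b' \<and> c = c'"
    using * S(1) T(1) by (metis zero_neq_one)
  then show "inner S T = (if S = T then 1 else 0)"
    using * by simp
next
  fix T :: "('a, 'b) tensor"
  show "(\<forall>U\<in>Basis. inner T U = 0) \<longleftrightarrow> T = 0"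
  proof
    assume "\<forall>U\<in>Basis. inner T U = 0"
    then have "\<forall>b\<in>Basis. \<forall>c\<in>Basis. inner (tensor_apply T b) c = 0"
      by (auto simp: Basis_tensor_def inner_pure_tensor_right)
    then have "\<forall>b\<in>Basis. tensor_apply T b = 0"
      using euclidean_all_zero_iff by blast
    then have "inner T T = 0"
      by (simp add: inner_tensor.rep_eq)
    then show "T = 0"
      by simp
  qed simp
qed

end

lemma span_pure_tensor: "span {pure_tensor v w |v w. True} = UNIV"
proof -
  have "span Basis \<subseteq> span {pure_tensor v w |v w. True}"
    by (intro span_mono) (auto simp: Basis_tensor_def)
  then show ?thesis
    by auto
qed

lemma tensor_universal:
  fixes f :: "'a::euclidean_space \<Rightarrow> 'b::euclidean_space \<Rightarrow> 'c::real_vector"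
  assumes f: "bilinear f"
  shows "\<exists>!F. linear F \<and> (\<forall>v w. F (pure_tensor v w) = f v w)"
proof -
  define F where "F T = (\<Sum>b\<in>Basis. f b (tensor_apply T b))" for T
  have f1: "linear (\<lambda>v. f v w)" and f2: "linear (f v)" for v w
    using f by (auto simp: bilinear_def)
  have lin: "linear F"
    unfolding linear_iff F_def
    by (simp add: plus_tensor.rep_eq scaleR_tensor.rep_eq bilinear_radd [OF f]
        bilinear_rmul [OF f] sum.distrib scaleR_sum_right)
  have F: "F (pure_tensor v w) = f v w" for v w
  proof -
    have "F (pure_tensor v w) = (\<Sum>b\<in>Basis. inner v b *\<^sub>R f b w)"
      by (simp add: F_def pure_tensor.rep_eq bilinear_rmul [OF f])
    also have "\<dots> = f (\<Sum>b\<in>Basis. inner v b *\<^sub>R b) w"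
      using linear_sum [OF f1, of "\<lambda>b. inner v b *\<^sub>R b" Basis w]
      by (simp add: bilinear_lmul [OF f])
    finally show ?thesis
      by (simp add: euclidean_representation)
  qed
  have "G = F"
    if G: "linear G" "\<forall>v w. G (pure_tensor v w) = f v w" for G
  proof
    fix T :: "('a, 'b) tensor"
    have "T \<in> span {pure_tensor v w |v w. True}"
      using span_pure_tensor by auto
    then show "G T = F T"
    proof (rule linear_eq_on [OF G(1) lin])
      fix x :: "('a, 'b) tensor"
      assume "x \<in> {pure_tensor v w |v w. True}"
      then obtain v w where "x = pure_tensor v w"
        by auto
      then show "G x = F x"
        using G(2) F [of v w] by simp
    qed
  qed
  then show ?thesis
    using lin F by blast
qed

text \<open>The tensor product of two linear maps; in terms of linear maps it sends
  \<open>T\<close> to \<open>g \<circ> T \<circ> f\<^sup>*\<close>.\<close>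

definition tensor_map ::
    "('a::euclidean_space \<Rightarrow> 'c::euclidean_space) \<Rightarrow> ('b::euclidean_space \<Rightarrow> 'd::euclidean_space)
      \<Rightarrow> ('a, 'b) tensor \<Rightarrow> ('c, 'd) tensor" where
  "tensor_map f g T = Abs_tensor (\<lambda>u. g (tensor_apply T (adjoint f u)))"

lemma tensor_apply_tensor_map:
  assumes "linear f" "linear g"
  shows "tensor_apply (tensor_map f g T) = (\<lambda>u. g (tensor_apply T (adjoint f u)))"
proof -
  have "linear (\<lambda>u. g (tensor_apply T (adjoint f u)))"
    using linear_compose [OF linear_compose [OF adjoint_linear [OF assms(1)]
          linear_tensor_apply [of T]] assms(2)] by (simp add: o_def)
  then show ?thesis
    unfolding tensor_map_def by (subst Abs_tensor_inverse) auto
qed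

lemma linear_tensor_map:
  assumes "linear f" "linear g"
  shows "linear (tensor_map f g)"
  unfolding linear_iff
  by (intro conjI allI; rule tensor_eqI)
    (simp_all add: tensor_apply_tensor_map [OF assms] plus_tensor.rep_eq scaleR_tensor.rep_eq
      linear_add [OF assms(2)] linear_scale [OF assms(2)])

lemma tensor_map_pure_tensor:
  assumes "linear f" "linear g"
  shows "tensor_map f g (pure_tensor v w) = pure_tensor (f v) (g w)"
  by (rule tensor_eqI)
    (simp add: tensor_apply_tensor_map [OF assms] pure_tensor.rep_eq linear_scale [OF assms(2)]
      adjoint_works [OF assms(1)])


section \<open>Lattices\<close>

text \<open>A basis of \<open>L\<close> is encoded as a list without repetitions. Since \<open>lattice\<close> is already
  the type class of order lattices, the predicate is called \<open>is_lattice\<close>.\<close>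

definition lattice_basis :: "'a::euclidean_space list \<Rightarrow> 'a set \<Rightarrow> bool" where
  "lattice_basis xs L \<longleftrightarrow> distinct xs \<and> independent (set xs) \<and> group_closure (set xs) = L"

definition is_lattice :: "'a::euclidean_space set \<Rightarrow> bool" where
  "is_lattice L \<longleftrightarrow> (\<exists>B. independent B \<and> group_closure B = L)"

definition lattice_tensor ::
    "'a::euclidean_space set \<Rightarrow> 'b::euclidean_space set \<Rightarrow> ('a, 'b) tensor set" where
  "lattice_tensor L M = group_closure {pure_tensor x y |x y. x \<in> L \<and> y \<in> M}"

text \<open>Orthogonal projection of the ambient space onto a subspace.\<close>

definition orth_proj :: "'a::euclidean_space set \<Rightarrow> 'a \<Rightarrow> 'a" where
  "orth_proj S x = (THE y. y \<in> S \<and> x - y \<in> orthogonal_comp S)"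

lemma orth_proj_unique:
  fixes S :: "'a::euclidean_space set"
  assumes S: "subspace S"
  shows "\<exists>!y. y \<in> S \<and> x - y \<in> orthogonal_comp S"
proof -
  obtain y z where yz: "y \<in> span S" "\<And>w. w \<in> span S \<Longrightarrow> orthogonal z w" "x = y + z"
    using orthogonal_subspace_decomp_exists [of S x] by metis
  moreover have "span S = S"
    using S by (simp add: span_eq_iff)
  ultimately have "y \<in> S \<and> x - y \<in> orthogonal_comp S"
    by (auto simp: orthogonal_comp_def orthogonal_commute)
  moreover have "y1 = y2"
    if "y1 \<in> S \<and> x - y1 \<in> orthogonal_comp S" "y2 \<in> S \<and> x - y2 \<in> orthogonal_comp S" for y1 y2
  proof -
    have "y1 - y2 \<in> S"
      using that S by (auto intro: subspace_diff)
    moreover have "(x - y2) - (x - y1) \<in> orthogonal_comp S"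
      using that by (blast intro: subspace_diff subspace_orthogonal_comp)
    ultimately have "orthogonal (y1 - y2) (y1 - y2)"
      by (auto simp: orthogonal_comp_def)
    then show ?thesis
      by (simp add: orthogonal_self)
  qed
  ultimately show ?thesis
    by blast
qed

lemma orth_proj_works:
  assumes "subspace S"
  shows "orth_proj S x \<in> S" "x - orth_proj S x \<in> orthogonal_comp S"
  using theI' [OF orth_proj_unique [OF assms, of x]] by (auto simp: orth_proj_def)

lemma orth_proj_eqI:
  assumes "subspace S" "y \<in> S" "x - y \<in> orthogonal_comp S"
  shows "orth_proj S x = y"
  using orth_proj_unique [OF assms(1), of x] orth_proj_works [OF assms(1), of x] assms by blast

lemma linear_orth_proj:
  assumes S: "subspace S"
  shows "linear (orth_proj S)"
proof (rule linearI)
  note C = subspace_orthogonal_comp [of S]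
  fix x y :: 'a and c :: real
  have "(x + y) - (orth_proj S x + orth_proj S y) = (x - orth_proj S x) + (y - orth_proj S y)"
    by simp
  then show "orth_proj S (x + y) = orth_proj S x + orth_proj S y"
    by (intro orth_proj_eqI [OF S] subspace_add [OF S] orth_proj_works [OF S])
      (simp only:, intro subspace_add [OF C] orth_proj_works [OF S])
  have "c *\<^sub>R x - c *\<^sub>R orth_proj S x = c *\<^sub>R (x - orth_proj S x)"
    by (simp add: scaleR_diff_right)
  then show "orth_proj S (c *\<^sub>R x) = c *\<^sub>R orth_proj S x"
    by (intro orth_proj_eqI [OF S] subspace_scale [OF S] orth_proj_works [OF S])
      (simp only:, intro subspace_scale [OF C] orth_proj_works [OF S])
qed

text \<open>The projection of \<open>L\<close> onto the quotient lattice \<open>L/K\<close>, for a normal sublattice \<open>K\<close> of \<open>L\<close>;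
  it is extended linearly to the whole ambient space.\<close>

definition quotient_proj :: "'a::euclidean_space set \<Rightarrow> 'a set \<Rightarrow> 'a \<Rightarrow> 'a" where
  "quotient_proj L K = orth_proj (span L \<inter> orthogonal_comp (span K))"

definition quotient_lattice :: "'a::euclidean_space set \<Rightarrow> 'a set \<Rightarrow> 'a set" where
  "quotient_lattice L K = quotient_proj L K ` L"

lemma linear_quotient_proj: "linear (quotient_proj L K)"
  unfolding quotient_proj_def
  by (intro linear_orth_proj subspace_inter subspace_orthogonal_comp subspace_span)


section \<open>Volume\<close>

text \<open>A linear operator \<open>T\<close> on a subspace with orthonormal basis \<open>es\<close> has as its matrix
  the entries \<open>\<langle>e\<^sub>i, T e\<^sub>j\<rangle>\<close>. The volume does not depend on the choices, so an
  arbitrary one is taken. The operator \<open>T\<close> is only relevant on the span of \<open>L\<close>.\<close>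

definition orthonormal_basis :: "'a::euclidean_space list \<Rightarrow> 'a set \<Rightarrow> bool" where
  "orthonormal_basis es V \<longleftrightarrow>
     distinct es \<and> pairwise orthogonal (set es) \<and> (\<forall>e\<in>set es. norm e = 1) \<and> span (set es) = V"

definition operator_matrix :: "'a::euclidean_space list \<Rightarrow> ('a \<Rightarrow> 'a) \<Rightarrow> real mat" where
  "operator_matrix es T =
     Matrix.mat (length es) (length es) (\<lambda>(i, j). inner (es ! i) (T (es ! j)))"

definition vol :: "'a::euclidean_space set \<Rightarrow> real" where
  "vol L = (SOME v. \<exists>xs es T.
     lattice_basis xs L \<and> orthonormal_basis es (span L) \<and> length xs = length es \<and>
     linear T \<and> (\<forall>i<length es. T (es ! i) = xs ! i) \<and>
     v = \<bar>Determinant.det (operator_matrix es T)\<bar>)"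


section \<open>Theta invariants and cohomology of complexes of lattices\<close>

definition rho :: "'a::real_normed_vector set \<Rightarrow> real" where
  "rho S = (\<Sum>\<^sub>\<infinity>x\<in>S. exp (- pi * (norm x)\<^sup>2))"

definition ell :: "'a::real_normed_vector set \<Rightarrow> real" where
  "ell L = ln (rho L)"

text \<open>A lattice homomorphism is given by its domain lattice and a function whose values
  outside that lattice are irrelevant.\<close>

definition Ker :: "'a::real_normed_vector set \<Rightarrow> ('a \<Rightarrow> 'b::real_normed_vector) \<Rightarrow> 'a set" where
  "Ker L f = {x \<in> L. f x = 0}"

definition nul :: "'a::real_normed_vector set \<Rightarrow> ('a \<Rightarrow> 'b::real_normed_vector) \<Rightarrow> real" where
  "nul L f = ell (Ker L f)"

definition rk :: "'a::real_normed_vector set \<Rightarrow> ('a \<Rightarrow> 'b::real_normed_vector) \<Rightarrow> real" where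
  "rk L f = ell L - nul L f"

text \<open>A chain complex \<open>0 \<rightarrow> A\<^sub>1 \<rightarrow> A\<^sub>2 \<rightarrow> \<dots>\<close> of lattices lying in one space is the pair of the sequence
  of lattices, with \<open>A\<^sub>0 = 0\<close>, and the sequence of maps \<open>a\<^sub>k : A\<^sub>k \<rightarrow> A\<^sub>k\<^sub>+\<^sub>1\<close>.\<close>

type_synonym 'v lattice_complex = "(nat \<Rightarrow> 'v set) \<times> (nat \<Rightarrow> 'v \<Rightarrow> 'v)"

definition h_complex :: "nat \<Rightarrow> 'v::real_normed_vector lattice_complex \<Rightarrow> real" where
  "h_complex k A = nul (fst A (k + 1)) (snd A (k + 1)) - rk (fst A k) (snd A k)"


section \<open>The resolutions and the cohomology of a lattice\<close>

text \<open>Only \<open>n \<ge> 1\<close> is meaningful below; the junk value at \<open>n = 0\<close> does not affect the limits.\<close>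

definition P_lat :: "nat \<Rightarrow> (real^2) set" where
  "P_lat n = group_closure
     {vector [1 / real n, 0], vector [0, sqrt (1 / real n ^ 2 - 1 / real n ^ 4)]}"

text \<open>The image of the isometric embedding of \<open>\<int>\<close> into \<open>P_lat n\<close>.\<close>

definition Z_in_P :: "nat \<Rightarrow> (real^2) set" where
  "Z_in_P n = range (\<lambda>k::int. real_of_int k *\<^sub>R vector [1 / real n, sqrt (1 - 1 / real n ^ 2)])"

definition R_complex :: "'a::euclidean_space set \<Rightarrow> nat \<Rightarrow> (real^2, 'a) tensor lattice_complex" where
  "R_complex L n =
    ((\<lambda>k. if k = 1 then lattice_tensor (P_lat n) L
          else if k = 2 then lattice_tensor (quotient_lattice (P_lat n) (Z_in_P n)) L
          else {0}),
     (\<lambda>k. if k = 1 then tensor_map (quotient_proj (P_lat n) (Z_in_P n)) (\<lambda>y. y)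
          else (\<lambda>_. 0)))"

definition lattice_h :: "nat \<Rightarrow> 'a::euclidean_space set \<Rightarrow> real" where
  "lattice_h k L = lim (\<lambda>n. h_complex k (R_complex L n))"

definition euler_char :: "'a::euclidean_space set \<Rightarrow> real" where
  "euler_char L = lattice_h 0 L - lattice_h 1 L"

end

theory Submission
  imports
    Defs
    "HOL-Probability.Distributions"
    "HOL-Probability.Distribution_Functions"
    "HOL-Real_Asymp.Real_Asymp"
begin

text \<open>
  Write \<open>s = sqrt (1/n\<^sup>2 - 1/n\<^sup>4)\<close>. The generators of \<open>P\<^sub>n\<close> are orthogonal of lengths \<open>1/n\<close> and \<open>s\<close>,
  and \<open>P\<^sub>n/\<int>\<close> is generated by a vector of length \<open>s/n\<close>. Hence \<open>P\<^sub>n \<otimes> L\<close> is the orthogonal sum of the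
  rescaled lattices \<open>(1/n)L\<close> and \<open>sL\<close>, the lattice \<open>(P\<^sub>n/\<int>) \<otimes> L\<close> is \<open>(s/n)L\<close>, and the kernel of the
  projection is \<open>\<int> \<otimes> L = L\<close>. So \<open>h\<^sup>0\<close> is constant for \<open>n \<ge> 2\<close>, and \<open>h\<^sup>1\<close> follows from the
  asymptotics \<open>\<rho>(tL) ~ 1 / (vol(L) t\<^sup>d)\<close> as \<open>t\<close> tends to \<open>0\<close>, in which the powers of \<open>t\<close> cancel
  because \<open>(1/n) s = s/n\<close>.

  The asymptotics need no Poisson summation: in coordinates that make the basis of \<open>L\<close> triangular
  with diagonal \<open>r\<^sub>i\<close>, the sum is an iterated sum of shifted one-dimensional Gaussians, each of
  which is \<open>1/r\<^sub>i\<close> up to an additive error of at most 2, uniformly in the shift.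
\<close>

section \<open>One-dimensional Gaussian sums\<close>

text \<open>The normal law of mean 0 and variance \<open>1 / (2 * pi)\<close> has exactly the
  density \<open>exp (- pi * x\<^sup>2)\<close>, so its distribution function is a primitive
  \<open>G\<close> of total increment 1. All measure theory is confined here; later only bounds on
  increments and the two limits are used.\<close>

lemma gaussian_cdf:
  obtains G :: "real \<Rightarrow> real" where
    "\<And>x y l u. x < y \<Longrightarrow> 0 \<le> l \<Longrightarrow> (\<And>z. x < z \<Longrightarrow> z \<le> y \<Longrightarrow> l \<le> exp (- pi * z\<^sup>2) \<and> exp (- pi * z\<^sup>2) \<le> u) \<Longrightarrow>
       l * (y - x) \<le> G y - G x \<and> G y - G x \<le> u * (y - x)"
    "\<And>x y. G y - G x \<le> 1" "(G \<longlongrightarrow> 0) at_bot" "(G \<longlongrightarrow> 1) at_top"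
proof -
  define M where "M = density lborel (normal_density 0 (1 / sqrt (2 * pi)))"
  have nd: "normal_density 0 (1 / sqrt (2 * pi)) = (\<lambda>x. exp (- pi * x\<^sup>2))"
    by (auto simp: normal_density_def field_simps fun_eq_iff power_divide)
  interpret prob_space M
    unfolding M_def by (rule prob_space_normal_density) simp
  interpret real_distribution M
    by standard (simp_all add: M_def)
  show thesis
  proof
    fix x y l u :: real
    assume xy: "x < y" and l: "0 \<le> l"
      and b: "\<And>z. x < z \<Longrightarrow> z \<le> y \<Longrightarrow> l \<le> exp (- pi * z\<^sup>2) \<and> exp (- pi * z\<^sup>2) \<le> u"
    have u: "0 \<le> u" using b [of y] xy by (smt (verit) exp_ge_zero)
    have eq: "emeasure M {x<..y} = (\<integral>\<^sup>+z. ennreal (exp (- pi * z\<^sup>2)) * indicator {x<..y} z \<partial>lborel)"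
      unfolding M_def nd by (rule emeasure_density) auto
    have c: "(\<integral>\<^sup>+z. ennreal c * indicator {x<..y} z \<partial>lborel) = ennreal (c * (y - x))" if "c \<ge> 0" for c
      using xy that by (simp add: nn_integral_cmult_indicator ennreal_mult)
    have 1: "ennreal (l * (y - x)) \<le> emeasure M {x<..y}"
      unfolding eq c [OF l, symmetric] using b
      by (intro nn_integral_mono) (auto simp: indicator_def ennreal_leI)
    have 2: "emeasure M {x<..y} \<le> ennreal (u * (y - x))"
      unfolding eq c [OF u, symmetric] using b
      by (intro nn_integral_mono) (auto simp: indicator_def ennreal_leI)
    show "l * (y - x) \<le> cdf M y - cdf M x \<and> cdf M y - cdf M x \<le> u * (y - x)"
      unfolding cdf_diff_eq [OF xy] using 1 2 u xy
      by (simp add: emeasure_eq_measure ennreal_le_iff measure_nonneg)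
  next
    show "cdf M y - cdf M x \<le> 1" for x y
      using cdf_bounded_prob [of y] cdf_nonneg [of x] by linarith
  qed (rule cdf_lim_at_bot cdf_lim_at_top_prob)+
qed

text \<open>A Riemann sum of step \<open>r\<close> for a function of integral 1. On each cell it
  differs from the integral by at most \<open>r\<close> times the variation over that cell, and the
  total variation of the Gaussian is 2, whatever the offset \<open>t\<close>.\<close>

lemma gaussian_int_sum:
  fixes r t :: real
  assumes r: "r > 0"
  defines "f \<equiv> \<lambda>k::int. exp (- pi * (r * real_of_int k + t)\<^sup>2)"
  shows "f summable_on UNIV"
    and "max 0 (1 - 2 * r) \<le> r * infsum f UNIV"
    and "r * infsum f UNIV \<le> 1 + 2 * r"
proof -
  obtain G :: "real \<Rightarrow> real" where
    G: "\<And>x y l u. x < y \<Longrightarrow> 0 \<le> l \<Longrightarrow> (\<And>z. x < z \<Longrightarrow> z \<le> y \<Longrightarrow> l \<le> exp (- pi * z\<^sup>2) \<and> exp (- pi * z\<^sup>2) \<le> u) \<Longrightarrow>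
       l * (y - x) \<le> G y - G x \<and> G y - G x \<le> u * (y - x)" and
    G1: "\<And>x y. G y - G x \<le> 1" and Gbot: "(G \<longlongrightarrow> 0) at_bot" and Gtop: "(G \<longlongrightarrow> 1) at_top"
    using gaussian_cdf by metis
  define g where "g x = exp (- pi * x\<^sup>2)" for x :: real
  \<comment> \<open>The total variation of \<open>g\<close> on \<open>(-\<infinity>, x]\<close>; the errors of the Riemann sum telescope against it.\<close>
  define V where "V x = (if x \<le> 0 then g x else 2 - g x)" for x
  define p where "p k = r * real_of_int k + t" for k
  have g01: "0 < g x" "g x \<le> 1" for x
    by (auto simp: g_def)
  have g_dec: "g y \<le> g x" if "0 \<le> x" "x \<le> y" for x y
    using that by (simp add: g_def)
  have g_inc: "g x \<le> g y" if "x \<le> y" "y \<le> 0" for x y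
    using g_dec [of "- y" "- x"] that by (simp add: g_def)
  have V02: "0 \<le> V x" "V x \<le> 2" for x
    using g01 [of x] by (auto simp: V_def)
  have V: "\<bar>g y - g x\<bar> \<le> V y - V x" if "x \<le> y" for x y
    using that g01 [of x] g01 [of y] g_dec [of x y] g_inc [of x y] by (auto simp: V_def)
  have step: "\<bar>r * g x - (G (x + r) - G x)\<bar> \<le> r * (V (x + r) - V x)" for x
  proof -
    \<comment> \<open>The truncation at 0 is there because \<open>G\<close> accepts only nonnegative
      lower bounds for the density.\<close>
    have "max 0 (g x - (V (x + r) - V x)) * (x + r - x) \<le> G (x + r) - G x \<and>
        G (x + r) - G x \<le> (g x + (V (x + r) - V x)) * (x + r - x)"
    proof (rule G)
      fix z assume "x < z" "z \<le> x + r"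
      then have "\<bar>g z - g x\<bar> \<le> V (x + r) - V x"
        using V [of x z] V [of z "x + r"] by linarith
      then show "max 0 (g x - (V (x + r) - V x)) \<le> exp (- pi * z\<^sup>2) \<and>
          exp (- pi * z\<^sup>2) \<le> g x + (V (x + r) - V x)"
        using g01 [of z] by (simp add: g_def abs_le_iff)
    qed (use r in auto)
    moreover have "(g x - (V (x + r) - V x)) * r \<le> max 0 (g x - (V (x + r) - V x)) * r"
      using r by (intro mult_right_mono) auto
    ultimately show ?thesis
      by (intro abs_leI; simp add: algebra_simps)
  qed
  \<comment> \<open>With the right end excluded, the cells that start at \<open>p k\<close> for
    \<open>k\<close> in \<open>I N\<close> tile exactly the interval from \<open>p (- int N)\<close>
    to \<open>p (int N)\<close>. Passing to \<open>Suc N\<close> adds one cell at each end.\<close>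
  define I where "I N = {- int N..<int N}" for N
  have fp: "f k = g (p k)" for k
    by (simp add: f_def g_def p_def)
  have finite_sum: "\<bar>r * sum f (I N) - (G (p (int N)) - G (p (- int N)))\<bar>
      \<le> r * (V (p (int N)) - V (p (- int N)))" for N
  proof (induction N)
    case 0
    then show ?case by (simp add: I_def)
  next
    case (Suc N)
    have "I (Suc N) = insert (- int (Suc N)) (insert (int N) (I N))"
      by (auto simp: I_def)
    then have "sum f (I (Suc N)) = f (- int (Suc N)) + f (int N) + sum f (I N)"
      by (simp add: I_def)
    moreover have "p (int N) + r = p (int (Suc N))" "p (- int (Suc N)) + r = p (- int N)"
      by (simp_all add: p_def algebra_simps)
    ultimately show ?case
      using Suc step [of "p (int N)"] step [of "p (- int (Suc N))"]
      by (simp add: fp algebra_simps abs_le_iff)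
  qed
  have V2: "r * (V y - V x) \<le> 2 * r" for x y
    using V02 [of x] V02 [of y] r mult_left_mono [of "V y - V x" 2 r] by simp
  have I_bound: "r * sum f (I N) \<le> 1 + 2 * r" for N
    using finite_sum [of N] V2 G1 [of "p (int N)" "p (- int N)"] by (smt (verit))
  have f0: "0 \<le> f k" for k
    by (simp add: f_def)
  have bound: "sum f F \<le> (1 + 2 * r) / r" if "finite F" for F
  proof -
    obtain N where "F \<subseteq> I N"
    proof
      \<comment> \<open>The sum of the absolute values bounds each of them and is also meaningful
        for empty \<open>F\<close>.\<close>
      define N where "N = (\<Sum>k\<in>F. nat \<bar>k\<bar>)"
      show "F \<subseteq> I (Suc N)"
      proof
        fix k assume "k \<in> F"
        then have "nat \<bar>k\<bar> \<le> N"
          unfolding N_def using \<open>finite F\<close> by (intro member_le_sum) auto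
        then show "k \<in> I (Suc N)"
          unfolding I_def by auto
      qed
    qed
    then have "sum f F \<le> sum f (I N)"
      using f0 by (intro sum_mono2) (auto simp: I_def)
    also have "\<dots> \<le> (1 + 2 * r) / r"
      using I_bound [of N] r by (simp add: field_simps)
    finally show ?thesis .
  qed
  show summ: "f summable_on UNIV"
    using bound f0 by (intro nonneg_bdd_above_summable_on) (auto simp: bdd_above_def)
  have "infsum f UNIV \<le> (1 + 2 * r) / r"
    using bound by (intro infsum_le_finite_sums summ) auto
  then show "r * infsum f UNIV \<le> 1 + 2 * r"
    using r by (simp add: field_simps)
  \<comment> \<open>The finite sums are at most the infinite one, so \<open>finite_sum\<close>
    bounds the increments of \<open>G\<close> from above; these increments tend to the full mass
    1.\<close>
  have "1 - 0 \<le> r * infsum f UNIV + 2 * r"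
  proof (rule tendsto_upperbound)
    have "filterlim (\<lambda>N. p (int N)) at_top sequentially" "filterlim (\<lambda>N. p (- int N)) at_bot sequentially"
      unfolding p_def using r by real_asymp+
    then show "(\<lambda>N. G (p (int N)) - G (p (- int N))) \<longlonglongrightarrow> 1 - 0"
      by (intro tendsto_diff filterlim_compose [OF Gbot] filterlim_compose [OF Gtop])
    have "sum f (I N) \<le> infsum f UNIV" for N
      using f0 by (intro finite_sum_le_infsum summ) (auto simp: I_def)
    then have "r * sum f (I N) \<le> r * infsum f UNIV" for N
      using r by simp
    then show "\<forall>\<^sub>F N in sequentially. G (p (int N)) - G (p (- int N)) \<le> r * infsum f UNIV + 2 * r"
      using finite_sum V2 by (intro always_eventually allI) (smt (verit))
  qed simp
  moreover have "0 \<le> r * infsum f UNIV"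
    using r f0 by (simp add: infsum_nonneg)
  ultimately show "max 0 (1 - 2 * r) \<le> r * infsum f UNIV"
    by simp
qed

section \<open>Triangular coordinates\<close>

lemma group_closure_of_int_scaleR:
  fixes x :: "'a::real_vector"
  assumes "x \<in> group_closure S"
  shows "of_int k *\<^sub>R x \<in> group_closure S"
proof (induction k rule: int_induct [where k = 0])
  case (step1 i)
  then show ?case
    using group_closure_add [OF step1(2) assms] by (simp add: algebra_simps)
next
  case (step2 i)
  then show ?case
    using group_closure.diff [OF step2(2) assms] by (simp add: algebra_simps)
qed simp

lemma group_closure_mono: "S \<subseteq> T \<Longrightarrow> group_closure S \<subseteq> group_closure T"
proof
  fix x assume "S \<subseteq> T" "x \<in> group_closure S"
  from this(2) show "x \<in> group_closure T"
    by induction (use \<open>S \<subseteq> T\<close> in \<open>auto intro: group_closure.intros\<close>)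
qed

lemma group_closure_subset_span: "group_closure S \<subseteq> span S"
proof
  fix x assume "x \<in> group_closure S"
  then show "x \<in> span S"
    by induction (auto intro: span_base span_diff span_zero)
qed

lemma span_group_closure: "span (group_closure S) = span S"
proof (rule span_eq [THEN iffD2], intro conjI group_closure_subset_span)
  show "S \<subseteq> span (group_closure S)"
    by (auto intro!: span_base group_closure.base)
qed

text \<open>Splitting off one generator is what turns a sum over a lattice into a sum over an
  integer and a lattice of smaller rank.\<close>

lemma group_closure_insert:
  fixes x :: "'a::real_vector"
  shows "group_closure (insert x S) = (\<lambda>(k, y). of_int k *\<^sub>R x + y) ` (UNIV \<times> group_closure S)"
proof (intro equalityI subsetI)
  fix z assume "z \<in> group_closure (insert x S)"
  then show "z \<in> (\<lambda>(k, y). of_int k *\<^sub>R x + y) ` (UNIV \<times> group_closure S)"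
  proof induction
    case (base s)
    \<comment> \<open>The base rule of \<open>group_closure\<close> also produces \<open>0\<close>,
      hence \<open>insert 0 S\<close> in the second case.\<close>
    then consider "s = of_int 1 *\<^sub>R x + 0" | "s = of_int 0 *\<^sub>R x + s" "s \<in> insert 0 S"
      by auto
    then show ?case
    proof cases
      case 1
      then show ?thesis by (intro image_eqI [of _ _ "(1, 0)"]) auto
    next
      case 2
      then show ?thesis by (intro image_eqI [of _ _ "(0, s)"]) (auto intro: group_closure.base)
    qed
  next
    case (diff s t)
    then obtain k y l z where "s = of_int k *\<^sub>R x + y" "t = of_int l *\<^sub>R x + z"
      "y \<in> group_closure S" "z \<in> group_closure S"
      by auto
    then show ?case
      by (intro image_eqI [of _ _ "(k - l, y - z)"]) (auto simp: algebra_simps intro: group_closure.diff)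
  qed
next
  fix z assume "z \<in> (\<lambda>(k, y). of_int k *\<^sub>R x + y) ` (UNIV \<times> group_closure S)"
  moreover have "x \<in> group_closure (insert x S)" "group_closure S \<subseteq> group_closure (insert x S)"
    by (rule group_closure.base, simp, rule group_closure_mono, blast)
  ultimately show "z \<in> group_closure (insert x S)"
    by (auto intro: group_closure_add group_closure_of_int_scaleR)
qed

lemma group_closure_linear_image:
  fixes f :: "'a::real_vector \<Rightarrow> 'b::real_vector"
  assumes "linear f"
  shows "group_closure (f ` S) = f ` group_closure S"
proof (intro equalityI subsetI)
  fix z assume "z \<in> group_closure (f ` S)"
  then show "z \<in> f ` group_closure S"
  proof induction
    case (base s)
    then show ?case
      using linear_0 [OF assms] by (auto intro: group_closure.base intro!: image_eqI [of 0 f 0])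
  next
    case (diff s t)
    then show ?case
      by (auto simp flip: linear_diff [OF assms] intro: group_closure.diff)
  qed
next
  fix z assume "z \<in> f ` group_closure S"
  then obtain y where y: "y \<in> group_closure S" "z = f y"
    by auto
  from y(1) have "f y \<in> group_closure (f ` S)"
    by induction (auto simp: linear_diff [OF assms] linear_0 [OF assms] intro: group_closure.intros)
  then show "z \<in> group_closure (f ` S)"
    using y by simp
qed

text \<open>\<open>es\<close> is the result of the Gram--Schmidt process on \<open>xs\<close>, run from the last vector to the first.\<close>

fun triangularizes :: "'a::euclidean_space list \<Rightarrow> 'a list \<Rightarrow> bool" where
  "triangularizes [] [] \<longleftrightarrow> True"
| "triangularizes (e # es) (x # xs) \<longleftrightarrow>
     norm e = 1 \<and> (\<forall>y\<in>span (set es). inner e y = 0) \<and> 0 < inner e x \<and>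
     x - inner e x *\<^sub>R e \<in> span (set es) \<and> triangularizes es xs"
| "triangularizes _ _ \<longleftrightarrow> False"

section \<open>Orthonormal systems adapted to a basis\<close>

lemma triangularizes_length: "triangularizes es xs \<Longrightarrow> length es = length xs"
  by (induction es xs rule: triangularizes.induct) auto

lemma triangularizes_span: "triangularizes es xs \<Longrightarrow> span (set es) = span (set xs)"
proof (induction es xs rule: triangularizes.induct)
  case (2 e es x xs)
  then have IH: "span (set es) = span (set xs)" by simp
  define r where "r = inner e x"
  have r: "r \<noteq> 0" and d: "x - r *\<^sub>R e \<in> span (set es)"
    using 2 by (auto simp: r_def)
  have 1: "x \<in> span (insert e (set es))"
    using d by (auto simp: span_insert)
  \<comment> \<open>Since the diagonal entry \<open>r\<close> is nonzero, \<open>e\<close> can be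
    recovered from \<open>x\<close> modulo the span of the later vectors.\<close>
  have 2: "e \<in> span (insert x (set xs))"
  proof -
    have "- (1 / r) *\<^sub>R (x - r *\<^sub>R e) \<in> span (set es)"
      using d by (rule span_scale)
    then have "e - (1 / r) *\<^sub>R x \<in> span (set xs)"
      using r IH by (simp add: algebra_simps)
    then show ?thesis
      by (auto simp: span_insert)
  qed
  have "set es \<subseteq> span (set xs)" "set xs \<subseteq> span (set es)"
    using IH span_superset by auto
  then have "set es \<subseteq> span (insert x (set xs))" "set xs \<subseteq> span (insert e (set es))"
    by (blast intro: span_mono [THEN subsetD, rotated])+
  then show ?case
    using 1 2 by (simp add: span_eq)
qed auto

lemma triangularizes_orthonormal:
  "triangularizes es xs \<Longrightarrow> orthonormal_basis es (span (set xs))"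
proof (induction es xs rule: triangularizes.induct)
  case (2 e es x xs)
  then have orth: "inner e y = 0" if "y \<in> set es" for y
    using that by (auto intro: span_base)
  then have "e \<notin> set es"
    using 2 by (auto simp: norm_eq_1)
  moreover have "orthonormal_basis es (span (set xs))"
    using 2 by simp
  ultimately show ?case
    using orth "2.prems" triangularizes_span [OF "2.prems"]
    by (auto simp: orthonormal_basis_def pairwise_insert real_inner_class.orthogonal_def inner_commute)
qed (auto simp: orthonormal_basis_def)

text \<open>The process starts from the last vector, so \<open>xs ! j\<close> lies in the span of
  the entries of \<open>es\<close> from position \<open>j\<close> on, and the earlier ones are
  orthogonal to it. The matrix of these inner products is thus lower triangular.\<close>

lemma triangularizes_upper:
  "triangularizes es xs \<Longrightarrow> i < j \<Longrightarrow> j < length xs \<Longrightarrow> inner (es ! i) (xs ! j) = 0"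
proof (induction es xs arbitrary: i j rule: triangularizes.induct)
  case (2 e es x xs)
  obtain k where j: "j = Suc k" "k < length xs"
    using "2.prems" by (cases j) auto
  show ?case
  proof (cases i)
    case 0
    have "xs ! k \<in> span (set es)"
      using triangularizes_span [of es xs] "2.prems" j by (auto intro: span_base)
    then show ?thesis
      using "2.prems" 0 j by auto
  next
    case (Suc i')
    then show ?thesis
      using "2.prems" j "2.IH" [of i' k] by auto
  qed
qed auto

text \<open>The orthonormal vectors do not change under scaling, so a single \<open>es\<close>
  serves for all \<open>t\<close> in the limit.\<close>

lemma triangularizes_scale:
  "c > 0 \<Longrightarrow> triangularizes es xs \<Longrightarrow> triangularizes es (map ((*\<^sub>R) c) xs)"
proof (induction es xs rule: triangularizes.induct)
  case (2 e es x xs)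
  then have "c *\<^sub>R (x - inner e x *\<^sub>R e) \<in> span (set es)"
    by (intro span_scale) auto
  then show ?case
    using 2 by (simp add: algebra_simps)
qed auto

text \<open>By independence the component of \<open>x\<close> orthogonal to the later vectors is
  nonzero. Normalising it gives \<open>e\<close>, and its norm is the positive diagonal
  entry.\<close>

lemma triangularizes_exists:
  "distinct xs \<Longrightarrow> independent (set xs) \<Longrightarrow> \<exists>es. triangularizes es xs"
proof (induction xs)
  case Nil
  then show ?case
    by (intro exI [of _ "[]"]) simp
next
  case (Cons x xs)
  then have x: "x \<notin> span (set xs)" and "independent (set xs)"
    by (auto simp: independent_insert split: if_splits)
  then obtain es where es: "triangularizes es xs"
    using Cons by auto
  obtain p q where pq: "p \<in> span (set xs)" "\<And>w. w \<in> span (set xs) \<Longrightarrow> orthogonal q w" "x = p + q"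
    using orthogonal_subspace_decomp_exists [of "set xs" x] by metis
  have q: "q \<noteq> 0"
    using pq x by auto
  define e where "e = q /\<^sub>R norm q"
  have "inner e x = norm q"
    using pq(2) [OF pq(1)] q
    by (simp add: e_def pq(3) inner_add_right real_inner_class.orthogonal_def flip: power2_norm_eq_inner)
      (simp add: power2_eq_square)
  moreover from this have "x - inner e x *\<^sub>R e = p"
    using pq q by (simp add: e_def)
  ultimately have "triangularizes (e # es) (x # xs)"
    using pq q es triangularizes_span [OF es] by (auto simp: e_def real_inner_class.orthogonal_def)
  then show ?case ..
qed

section \<open>Gaussian sums over lattices\<close>

text \<open>The factors of the lower bound are truncated at \<open>0\<close> so that lower bounds can be multiplied.\<close>

definition gaussian_lower :: "'a::euclidean_space list \<Rightarrow> 'a list \<Rightarrow> real" where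
  "gaussian_lower es xs = prod_list (map2 (\<lambda>e x. max 0 (1 - 2 * inner e x)) es xs)"

definition gaussian_upper :: "'a::euclidean_space list \<Rightarrow> 'a list \<Rightarrow> real" where
  "gaussian_upper es xs = prod_list (map2 (\<lambda>e x. 1 + 2 * inner e x) es xs)"

text \<open>For a triangularized basis this is the covolume, being the determinant of a triangular
  matrix.\<close>

definition diagonal_prod :: "'a::euclidean_space list \<Rightarrow> 'a list \<Rightarrow> real" where
  "diagonal_prod es xs = prod_list (map2 inner es xs)"

lemma gaussian_prod_Nil [simp]:
  "gaussian_lower [] [] = 1" "gaussian_upper [] [] = 1" "diagonal_prod [] [] = 1"
  by (simp_all add: gaussian_lower_def gaussian_upper_def diagonal_prod_def)

lemma gaussian_prod_Cons [simp]:
  "gaussian_lower (e # es) (x # xs) = max 0 (1 - 2 * inner e x) * gaussian_lower es xs"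
  "gaussian_upper (e # es) (x # xs) = (1 + 2 * inner e x) * gaussian_upper es xs"
  "diagonal_prod (e # es) (x # xs) = inner e x * diagonal_prod es xs"
  by (simp_all add: gaussian_lower_def gaussian_upper_def diagonal_prod_def)

lemma diagonal_prod_pos: "triangularizes es xs \<Longrightarrow> 0 < diagonal_prod es xs"
  by (induction es xs rule: triangularizes.induct) auto

lemma gaussian_upper_nonneg: "triangularizes es xs \<Longrightarrow> 0 \<le> gaussian_upper es xs"
  by (induction es xs rule: triangularizes.induct) auto

lemma gaussian_lower_nonneg: "triangularizes es xs \<Longrightarrow> 0 \<le> gaussian_lower es xs"
  by (induction es xs rule: triangularizes.induct) auto

lemma norm_square_orthogonal_split:
  fixes e w :: "'a::real_inner"
  assumes "norm e = 1" "inner e w = 0"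
  shows "(norm (s *\<^sub>R e + w))\<^sup>2 = s\<^sup>2 + (norm w)\<^sup>2"
  using norm_add_Pythagorean [of "s *\<^sub>R e" w] assms by (simp add: real_inner_class.orthogonal_def)

text \<open>Induction on the basis. For a fixed coefficient \<open>k\<close> of \<open>x\<close>,
  Pythagoras splits off a one-dimensional Gaussian factor, and what remains is a sum over the
  smaller lattice with a shift depending on \<open>k\<close>. This is why a shift \<open>c\<close>
  is carried along. The bounds do not depend on it, so they factor out of the sum over
  \<open>k\<close>, which \<open>gaussian_int_sum\<close> controls.\<close>

lemma gaussian_lattice_sum_bounds:
  assumes "triangularizes es xs" and "c \<in> span (set es)"
  defines "f \<equiv> \<lambda>c y. exp (- pi * (norm (y + c))\<^sup>2)"
  shows "f c summable_on group_closure (set xs) \<and>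
    gaussian_lower es xs \<le> diagonal_prod es xs * infsum (f c) (group_closure (set xs)) \<and>
    diagonal_prod es xs * infsum (f c) (group_closure (set xs)) \<le> gaussian_upper es xs"
  using assms(1,2)
proof (induction es xs arbitrary: c rule: triangularizes.induct)
  case 1
  then show ?case
    by (simp add: f_def)
next
  case (2 e es x xs)
  define L where "L = group_closure (set xs)"
  define D where "D = diagonal_prod es xs"
  define r where "r = inner e x"
  define p where "p = x - r *\<^sub>R e"
  have e: "norm e = 1" and e_orth: "\<And>y. y \<in> span (set es) \<Longrightarrow> inner e y = 0" and
    r: "0 < r" and p: "p \<in> span (set es)" and tri: "triangularizes es xs"
    using "2.prems" by (auto simp: r_def p_def)
  have D: "0 < D"
    unfolding D_def using tri by (rule diagonal_prod_pos)
  have IH: "f c summable_on L" "gaussian_lower es xs \<le> D * infsum (f c) L"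
      "D * infsum (f c) L \<le> gaussian_upper es xs" if "c \<in> span (set es)" for c
    using "2.IH" [OF tri that] by (auto simp: L_def D_def)
  have L_span: "y \<in> span (set es)" if "y \<in> L" for y
    using that group_closure_subset_span triangularizes_span [OF tri] by (auto simp: L_def)
  \<comment> \<open>The coordinate of the shift along \<open>e\<close>; it becomes the offset of the
    one-dimensional sum.\<close>
  obtain t where t: "c - t *\<^sub>R e \<in> span (set es)"
    using "2.prems" by (auto simp: span_insert)
  define c' where "c' k = of_int k *\<^sub>R p + (c - t *\<^sub>R e)" for k :: int
  have c': "c' k \<in> span (set es)" for k
    unfolding c'_def by (intro span_add span_scale p t)
  define g where "g k = exp (- pi * (r * real_of_int k + t)\<^sup>2)" for k :: int
  define h where "h = (\<lambda>(k::int, y). of_int k *\<^sub>R x + y)"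
  have fh: "f c (h (k, y)) = g k * f (c' k) y" if "y \<in> L" for k y
  proof -
    have "inner e (y + c' k) = 0"
      using L_span [OF that] c' by (intro e_orth span_add) auto
    moreover have "h (k, y) + c = (r * of_int k + t) *\<^sub>R e + (y + c' k)"
      by (simp add: h_def c'_def p_def algebra_simps)
    ultimately show ?thesis
      using norm_square_orthogonal_split [OF e, of "y + c' k" "r * of_int k + t"]
      by (simp add: f_def g_def algebra_simps flip: exp_add)
  qed
  \<comment> \<open>The inner product with \<open>e\<close> kills \<open>y\<close> and equals
    \<open>r\<close> times \<open>k\<close>, so it recovers \<open>k\<close>.\<close>
  have inj: "inj_on h (UNIV \<times> L)"
  proof (rule inj_onI, clarify)
    fix k l y z assume yz: "y \<in> L" "z \<in> L" and eq: "h (k, y) = h (l, z)"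
    have "inner e (h (k, y)) = of_int k * r" "inner e (h (l, z)) = of_int l * r"
      using L_span [OF yz(1), THEN e_orth] L_span [OF yz(2), THEN e_orth]
      by (simp_all add: h_def inner_add_right r_def)
    then have "k = l"
      using eq r by simp
    then show "k = l \<and> y = z"
      using eq by (simp add: h_def)
  qed
  have img: "group_closure (set (x # xs)) = h ` (UNIV \<times> L)"
    by (simp add: group_closure_insert h_def L_def)
  define S where "S k = g k * infsum (f (c' k)) L" for k
  have inner_sum: "((\<lambda>y. f c (h (k, y))) has_sum S k) L" for k
  proof -
    have "((\<lambda>y. g k * f (c' k) y) has_sum S k) L"
      unfolding S_def by (intro has_sum_cmult_right has_sum_infsum IH(1) c')
    then show ?thesis
      by (rule has_sum_cong [THEN iffD1, rotated]) (simp add: fh)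
  qed
  have g_summ: "g summable_on UNIV" and
    g_lower: "max 0 (1 - 2 * r) \<le> r * infsum g UNIV" and
    g_upper: "r * infsum g UNIV \<le> 1 + 2 * r"
    unfolding g_def using gaussian_int_sum [OF r, of t] by auto
  have g0: "0 \<le> g k" for k
    by (simp add: g_def)
  have S_lower: "gaussian_lower es xs * g k \<le> D * S k" and
    S_upper: "D * S k \<le> gaussian_upper es xs * g k" for k
    using mult_right_mono [OF IH(2) [OF c' [of k]] g0 [of k]]
      mult_right_mono [OF IH(3) [OF c' [of k]] g0 [of k]]
    by (simp_all add: S_def mult_ac)
  have S0: "0 \<le> S k" for k
    unfolding S_def f_def by (intro mult_nonneg_nonneg g0 infsum_nonneg) auto
  \<comment> \<open>The upper bound of the induction hypothesis, uniform in \<open>k\<close>,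
    dominates \<open>S\<close> by a multiple of \<open>g\<close>. As all terms are nonnegative, the
    double sum may then be taken iteratively.\<close>
  have S_summ: "S summable_on UNIV"
  proof (rule summable_on_comparison_test)
    show "(\<lambda>k. gaussian_upper es xs / D * g k) summable_on UNIV"
      by (intro summable_on_cmult_right g_summ)
    show "S k \<le> gaussian_upper es xs / D * g k" for k
      using S_upper [of k] D by (simp add: field_simps)
  qed (rule S0)
  have summ: "(\<lambda>z. f c (h z)) summable_on UNIV \<times> L"
    using inner_sum S_summ by (rule summable_on_SigmaI) (simp add: f_def)
  have "((\<lambda>z. f c (h z)) has_sum infsum S UNIV) (UNIV \<times> L)"
    using inner_sum has_sum_infsum [OF S_summ] summ by (rule has_sum_SigmaI)
  then have total: "(f c has_sum infsum S UNIV) (group_closure (set (x # xs)))"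
    unfolding img by (subst has_sum_reindex [OF inj]) (simp add: o_def)
  have DS: "D * infsum S UNIV = (\<Sum>\<^sub>\<infinity>k. D * S k)"
    by (rule infsum_cmult_right' [symmetric])
  have "gaussian_lower es xs * infsum g UNIV \<le> D * infsum S UNIV"
    unfolding DS infsum_cmult_right' [symmetric]
    by (intro infsum_mono summable_on_cmult_right g_summ S_summ S_lower)
  then have "r * (gaussian_lower es xs * infsum g UNIV) \<le> r * (D * infsum S UNIV)"
    using r by simp
  moreover have "gaussian_lower es xs * max 0 (1 - 2 * r) \<le> gaussian_lower es xs * (r * infsum g UNIV)"
    using gaussian_lower_nonneg [OF tri] by (intro mult_left_mono g_lower)
  moreover have "D * infsum S UNIV \<le> gaussian_upper es xs * infsum g UNIV"
    unfolding DS infsum_cmult_right' [symmetric]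
    by (intro infsum_mono summable_on_cmult_right g_summ S_summ S_upper)
  then have "r * (D * infsum S UNIV) \<le> r * (gaussian_upper es xs * infsum g UNIV)"
    using r by simp
  moreover have "gaussian_upper es xs * (r * infsum g UNIV) \<le> gaussian_upper es xs * (1 + 2 * r)"
    using gaussian_upper_nonneg [OF tri] by (intro mult_left_mono g_upper)
  ultimately show ?case
    using total infsumI [OF total] by (auto simp: summable_on_def mult_ac D_def simp flip: r_def)
qed auto

section \<open>Convergence of \<open>rho\<close> and its behaviour under shrinking the
  lattice\<close>

lemma summable_gaussian_lattice:
  assumes "is_lattice L"
  shows "(\<lambda>x. exp (- pi * (norm x)\<^sup>2)) summable_on L"
proof -
  obtain B where B: "independent B" "group_closure B = L"
    using assms by (auto simp: is_lattice_def)
  obtain xs where xs: "set xs = B" "distinct xs"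
    using finite_distinct_list [OF finiteI_independent [OF B(1)]] by auto
  obtain es where "triangularizes es xs"
    using triangularizes_exists [of xs] xs B by auto
  from gaussian_lattice_sum_bounds [OF this span_zero] show ?thesis
    using xs B by simp
qed

lemma rho_ge_1:
  fixes L :: "'a::euclidean_space set"
  assumes "is_lattice L"
  shows "1 \<le> rho L"
proof -
  have "0 \<in> L"
    using assms by (auto simp: is_lattice_def)
  have "sum (\<lambda>x. exp (- pi * (norm x)\<^sup>2)) {0::'a} \<le> rho L"
    unfolding rho_def using summable_gaussian_lattice [OF assms]
    by (rule finite_sum_le_infsum) (use \<open>0 \<in> L\<close> in auto)
  then show ?thesis
    by simp
qed

text \<open>Scaling by \<open>t\<close> multiplies every diagonal entry by \<open>t\<close>. Both
  bounds are then finite products whose factors tend to 1, and the diagonal product acquires one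
  power of \<open>t\<close> per basis vector.\<close>

lemma tendsto_rho_scaled:
  assumes tri: "triangularizes es xs" and L: "group_closure (set xs) = L"
  shows "((\<lambda>t. diagonal_prod es xs * t ^ length xs * rho ((*\<^sub>R) t ` L)) \<longlongrightarrow> 1) (at_right 0)"
proof (rule tendsto_sandwich)
  let ?xs = "\<lambda>t. map ((*\<^sub>R) t) xs"
  have diag: "diagonal_prod es (?xs t) = diagonal_prod es xs * t ^ length xs" for t
    using triangularizes_length [OF tri]
    by (induction es xs rule: list_induct2) (auto simp: mult_ac)
  have "gaussian_lower es (?xs t) \<le> diagonal_prod es (?xs t) * rho ((*\<^sub>R) t ` L) \<and>
      diagonal_prod es (?xs t) * rho ((*\<^sub>R) t ` L) \<le> gaussian_upper es (?xs t)" if "t > 0" for t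
    using gaussian_lattice_sum_bounds [OF triangularizes_scale [OF that tri] span_zero]
    by (simp add: rho_def group_closure_linear_image L)
  then show "\<forall>\<^sub>F t in at_right 0. gaussian_lower es (?xs t) \<le> diagonal_prod es xs * t ^ length xs * rho ((*\<^sub>R) t ` L)"
    "\<forall>\<^sub>F t in at_right 0. diagonal_prod es xs * t ^ length xs * rho ((*\<^sub>R) t ` L) \<le> gaussian_upper es (?xs t)"
    by (auto simp: diag eventually_at_right_less intro!: eventually_mono [OF eventually_at_right_less [of 0]])
  have lim: "((\<lambda>t::real. t * inner e x) \<longlongrightarrow> 0) (at_right 0)" for e x :: 'a
    by (rule tendsto_mult_left_zero) (rule tendsto_ident_at)
  show "((\<lambda>t. gaussian_lower es (?xs t)) \<longlongrightarrow> 1) (at_right 0)"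
    using triangularizes_length [OF tri]
  proof (induction es xs rule: list_induct2)
    case (Cons e es x xs)
    have "((\<lambda>t. max 0 (1 - 2 * (t * inner e x))) \<longlongrightarrow> max 0 (1 - 2 * 0)) (at_right 0)"
      by (intro tendsto_intros lim)
    then show ?case
      using tendsto_mult [OF _ Cons.IH] by fastforce
  qed simp
  show "((\<lambda>t. gaussian_upper es (?xs t)) \<longlongrightarrow> 1) (at_right 0)"
    using triangularizes_length [OF tri]
  proof (induction es xs rule: list_induct2)
    case (Cons e es x xs)
    have "((\<lambda>t. 1 + 2 * (t * inner e x)) \<longlongrightarrow> 1 + 2 * 0) (at_right 0)"
      by (intro tendsto_intros lim)
    then show ?case
      using tendsto_mult [OF _ Cons.IH] by fastforce
  qed simp
qed

section \<open>Volume\<close>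

text \<open>Parseval's identity, in the shape of an entry of a matrix product. The difference
  between \<open>x\<close> and its expansion lies in the span of \<open>es\<close> and is orthogonal
  to it, hence vanishes.\<close>

lemma orthonormal_basis_inner_expand:
  assumes es: "orthonormal_basis es V" and x: "x \<in> V"
  shows "inner y x = (\<Sum>k<length es. inner y (es ! k) * inner (es ! k) x)"
proof -
  let ?B = "set es"
  have orth: "inner a b = (if a = b then 1 else 0)" if "a \<in> ?B" "b \<in> ?B" for a b
    using es that by (auto simp: orthonormal_basis_def pairwise_def real_inner_class.orthogonal_def norm_eq_1)
  define d where "d = x - (\<Sum>b\<in>?B. inner b x *\<^sub>R b)"
  have d: "d \<in> span ?B"
  proof -
    have "x \<in> span ?B"
      using es x by (simp add: orthonormal_basis_def)
    then show ?thesis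
      unfolding d_def by (intro span_diff span_sum span_scale) (auto intro: span_base)
  qed
  have "orthogonal d b" if b: "b \<in> ?B" for b
  proof -
    have "(\<Sum>a\<in>?B. inner a x * inner a b) = (\<Sum>a\<in>?B. if a = b then inner a x else 0)"
      using b by (intro sum.cong) (auto simp: orth)
    then show ?thesis
      using b by (simp add: d_def real_inner_class.orthogonal_def inner_diff_left inner_sum_left
          inner_commute [of x b])
  qed
  then have "orthogonal d d"
    using orthogonal_to_span [OF d] by blast
  then have "x = (\<Sum>b\<in>?B. inner b x *\<^sub>R b)"
    by (simp add: orthogonal_self d_def)
  then have "inner y x = (\<Sum>b\<in>?B. inner y b * inner b x)"
    by (metis (no_types, lifting) inner_scaleR_right inner_sum_right mult.commute sum.cong)
  also have "\<dots> = (\<Sum>k<length es. inner y (es ! k) * inner (es ! k) x)"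
    using es by (intro sum.reindex_bij_betw [symmetric] bij_betw_nth) (auto simp: orthonormal_basis_def)
  finally show ?thesis .
qed

lemma diagonal_prod_eq_prod_nth:
  "length es = length xs \<Longrightarrow> diagonal_prod es xs = (\<Prod>i<length xs. inner (es ! i) (xs ! i))"
  by (induction es xs rule: list_induct2) (auto simp: prod.lessThan_Suc_shift simp del: prod.lessThan_Suc)

text \<open>The matrix factors as \<open>Q * R\<close>, where \<open>Q\<close> changes between the
  orthonormal bases \<open>es\<close> and \<open>fs\<close> and so has determinant of absolute value
  1, while \<open>R\<close> is triangular with the diagonal of \<open>fs\<close> against
  \<open>xs\<close>. The result mentions neither \<open>es\<close> nor \<open>T\<close>.\<close>

lemma det_operator_matrix:
  assumes es: "orthonormal_basis es V" and xs: "span (set xs) = V" and len: "length xs = length es"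
    and T: "\<And>i. i < length es \<Longrightarrow> T (es ! i) = xs ! i"
    and tri: "triangularizes fs xs"
  shows "\<bar>Determinant.det (operator_matrix es T)\<bar> = diagonal_prod fs xs"
proof -
  define n where "n = length xs"
  have fs: "orthonormal_basis fs V"
    using triangularizes_orthonormal [OF tri] xs by simp
  have lens [simp]: "length es = n" "length fs = n" "length xs = n"
    using len triangularizes_length [OF tri] by (simp_all add: n_def)
  have xV: "xs ! i \<in> V" if "i < n" for i
    using that xs by (auto intro: span_base)
  have V: "es ! i \<in> V" "fs ! i \<in> V" if "i < n" for i
    using es fs span_base [of "es ! i" "set es"] span_base [of "fs ! i" "set fs"] that
    by (simp_all add: orthonormal_basis_def)
  define Q where "Q = Matrix.mat n n (\<lambda>(i, j). inner (es ! i) (fs ! j))"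
  define R where "R = Matrix.mat n n (\<lambda>(i, j). inner (fs ! i) (xs ! j))"
  have [simp]: "Q \<in> carrier_mat n n" "R \<in> carrier_mat n n"
    by (simp_all add: Q_def R_def)
  have "operator_matrix es T = Q * R"
  proof (rule eq_matI)
    fix i j assume "i < dim_row (Q * R)" "j < dim_col (Q * R)"
    then have "i < n" "j < n"
      by (simp_all add: Q_def R_def)
    then show "operator_matrix es T $$ (i, j) = (Q * R) $$ (i, j)"
      using orthonormal_basis_inner_expand [OF fs xV [of j], of "es ! i"] T [of j]
      by (simp add: operator_matrix_def Q_def R_def scalar_prod_def atLeast0LessThan)
  qed (simp_all add: operator_matrix_def Q_def R_def)
  then have "Determinant.det (operator_matrix es T) = Determinant.det Q * Determinant.det R"
    by (simp add: det_mult [of _ n])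
  moreover have "\<bar>Determinant.det Q\<bar> = 1"
  proof -
    have "Q * transpose_mat Q = 1\<^sub>m n"
    proof (rule eq_matI)
      fix i j assume "i < dim_row (1\<^sub>m n :: real mat)" "j < dim_col (1\<^sub>m n :: real mat)"
      then have ij: "i < n" "j < n"
        by simp_all
      have "inner (es ! i) (es ! j) = (if i = j then 1 else 0)"
        using es ij by (auto simp: orthonormal_basis_def pairwise_def real_inner_class.orthogonal_def
            norm_eq_1 nth_eq_iff_index_eq)
      then show "(Q * transpose_mat Q) $$ (i, j) = 1\<^sub>m n $$ (i, j)"
        using ij orthonormal_basis_inner_expand [OF fs V(1) [of j], of "es ! i"]
        by (simp add: Q_def scalar_prod_def atLeast0LessThan inner_commute)
    qed (simp_all add: Q_def)
    then have "Determinant.det Q * Determinant.det Q = 1"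
      using det_mult [of Q n "transpose_mat Q"] by (simp add: det_transpose [of Q n])
    then show ?thesis
      by (auto simp: square_eq_1_iff)
  qed
  moreover have "Determinant.det R = diagonal_prod fs xs"
  proof -
    have "Determinant.det R = prod_list (diag_mat R)"
      by (rule det_lower_triangular [of n])
        (use triangularizes_upper [OF tri] in \<open>auto simp: R_def\<close>)
    then show ?thesis
      by (simp add: prod_list_diag_prod diagonal_prod_eq_prod_nth R_def atLeast0LessThan)
  qed
  moreover have "0 < diagonal_prod fs xs"
    by (rule diagonal_prod_pos [OF tri])
  ultimately show ?thesis
    by (simp add: abs_mult)
qed

text \<open>Once some witness is exhibited, the value chosen in \<open>vol\<close> comes with a
  basis of its own. Triangularizing that very basis avoids any comparison between two bases of
  \<open>L\<close>.\<close>

lemma vol_eq_diagonal_prod: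
  assumes "is_lattice L"
  obtains xs es where "group_closure (set xs) = L" "triangularizes es xs" "vol L = diagonal_prod es xs"
proof -
  let ?P = "\<lambda>v. \<exists>xs es T. lattice_basis xs L \<and> orthonormal_basis es (span L) \<and>
     length xs = length es \<and> linear T \<and> (\<forall>i<length es. T (es ! i) = xs ! i) \<and>
     v = \<bar>Determinant.det (operator_matrix es T)\<bar>"
  obtain B where B: "independent B" "group_closure B = L"
    using assms by (auto simp: is_lattice_def)
  obtain ys where ys: "set ys = B" "distinct ys"
    using finite_distinct_list [OF finiteI_independent [OF B(1)]] by auto
  obtain fs where fs: "triangularizes fs ys"
    using triangularizes_exists [of ys] ys B by auto
  have ob: "orthonormal_basis fs (span L)"
    using triangularizes_orthonormal [OF fs] ys B span_group_closure [of B] by simp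
  have len: "length ys = length fs"
    using triangularizes_length [OF fs] by simp
  have "independent (set fs)"
    using ob by (intro pairwise_orthogonal_independent) (auto simp: orthonormal_basis_def)
  \<comment> \<open>The operator is prescribed on the set of basis vectors, so the index of a vector
    has to be read off by inverting \<open>(!) fs\<close>.\<close>
  then obtain T where T: "linear T" "\<forall>e\<in>set fs. T e = ys ! (the_inv_into {..<length fs} ((!) fs) e)"
    using linear_independent_extend [of "set fs" "\<lambda>e. ys ! (the_inv_into {..<length fs} ((!) fs) e)"] by blast
  have "inj_on ((!) fs) {..<length fs}"
    using ob by (auto simp: orthonormal_basis_def inj_on_def nth_eq_iff_index_eq)
  then have "T (fs ! i) = ys ! i" if "i < length fs" for i
    using T(2) that by (simp add: the_inv_into_f_f)
  then have "?P \<bar>Determinant.det (operator_matrix fs T)\<bar>"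
    using ys B ob len T(1) by (intro exI [of _ ys] exI [of _ fs] exI [of _ T]) (auto simp: lattice_basis_def)
  then have "?P (vol L)"
    unfolding vol_def by (rule someI)
  then obtain xs es T where xs: "lattice_basis xs L" and es: "orthonormal_basis es (span L)"
    and "length xs = length es" "\<And>i. i < length es \<Longrightarrow> T (es ! i) = xs ! i"
    and vol: "vol L = \<bar>Determinant.det (operator_matrix es T)\<bar>"
    by blast
  moreover obtain gs where gs: "triangularizes gs xs"
    using triangularizes_exists [of xs] xs by (auto simp: lattice_basis_def)
  moreover have "span (set xs) = span L"
    using xs span_group_closure [of "set xs"] by (simp add: lattice_basis_def)
  ultimately have "vol L = diagonal_prod gs xs"
    using det_operator_matrix [of es "span L" xs T gs] by simp
  with gs xs show thesis
    by (intro that [of xs gs]) (auto simp: lattice_basis_def)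
qed

text \<open>The exponent stays anonymous: its powers cancel in the end, and it only matters that one
  \<open>d\<close> works for all \<open>t\<close>.\<close>

lemma tendsto_vol_rho_scaled:
  assumes "is_lattice L"
  obtains d where "((\<lambda>t. vol L * t ^ d * rho ((*\<^sub>R) t ` L)) \<longlongrightarrow> 1) (at_right 0)"
proof -
  obtain xs es where "group_closure (set xs) = L" "triangularizes es xs" "vol L = diagonal_prod es xs"
    using vol_eq_diagonal_prod [OF assms] .
  then show thesis
    using that tendsto_rho_scaled [of es xs L] by simp
qed

lemma vol_pos:
  assumes "is_lattice L"
  shows "0 < vol L"
proof -
  obtain xs es where "group_closure (set xs) = L" "triangularizes es xs" "vol L = diagonal_prod es xs"
    using vol_eq_diagonal_prod [OF assms] .
  then show ?thesis
    using diagonal_prod_pos by simp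
qed

section \<open>Tensor products with lattices in the plane\<close>

lemma norm_pure_tensor: "norm (pure_tensor v w) = norm v * norm w"
  by (simp add: norm_eq_sqrt_inner inner_pure_tensor real_sqrt_mult)

lemma linear_pure_tensor_right: "linear (pure_tensor v)"
  using bilinear_pure_tensor by (auto simp: bilinear_def)

lemma is_lattice_zero_diff:
  assumes "is_lattice L"
  shows "0 \<in> L" "x \<in> L \<Longrightarrow> y \<in> L \<Longrightarrow> x - y \<in> L"
  using assms by (auto simp: is_lattice_def intro: group_closure.diff)

lemma is_lattice_group_closure:
  assumes "is_lattice L"
  shows "group_closure L = L"
proof
  show "group_closure L \<subseteq> L"
  proof
    fix x assume "x \<in> group_closure L"
    then show "x \<in> L"
      by induction (auto intro: is_lattice_zero_diff [OF assms])
  qed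
qed (auto intro: group_closure.base)

text \<open>An integer multiple of \<open>q\<close> can be moved to the second factor, where
  \<open>L\<close> absorbs it.\<close>

lemma lattice_tensor_cyclic:
  assumes L: "is_lattice L"
  shows "lattice_tensor (group_closure {q}) L = pure_tensor q ` L"
proof -
  have "pure_tensor x y \<in> pure_tensor q ` L" if x: "x \<in> group_closure {q}" and y: "y \<in> L" for x y
  proof -
    obtain k :: int where "x = of_int k *\<^sub>R q"
      using x by (auto simp: group_closure_insert simp del: scaleR_cancel_right)
    moreover have "of_int k *\<^sub>R y \<in> L"
      using group_closure_of_int_scaleR [of y L k] y is_lattice_group_closure [OF L] by simp
    ultimately show ?thesis
      by (intro image_eqI [of _ _ "of_int k *\<^sub>R y"])
        (simp_all add: bilinear_lmul [OF bilinear_pure_tensor] bilinear_rmul [OF bilinear_pure_tensor])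
  qed
  moreover have "q \<in> group_closure {q}"
    by (rule group_closure.base) simp
  ultimately have "{pure_tensor x y |x y. x \<in> group_closure {q} \<and> y \<in> L} = pure_tensor q ` L"
    by blast
  then show ?thesis
    unfolding lattice_tensor_def
    by (simp add: group_closure_linear_image [OF linear_pure_tensor_right] is_lattice_group_closure [OF L])
qed

lemma lattice_tensor_two_generators:
  assumes L: "is_lattice L"
  shows "lattice_tensor (group_closure {u, v}) L = (\<lambda>(y, z). pure_tensor u y + pure_tensor v z) ` (L \<times> L)"
    (is "_ = ?R")
proof (rule antisym)
  let ?G = "{pure_tensor x y |x y. x \<in> group_closure {u, v} \<and> y \<in> L}"
  note rsub = bilinear_rsub [OF bilinear_pure_tensor]
    and rmul = bilinear_rmul [OF bilinear_pure_tensor] and rzero = bilinear_rzero [OF bilinear_pure_tensor]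
    and ladd = bilinear_ladd [OF bilinear_pure_tensor] and lmul = bilinear_lmul [OF bilinear_pure_tensor]
  have "x \<in> ?R" if "x \<in> group_closure ?G" for x
    using that
  proof induction
    case (base s)
    consider "s = 0" | a b :: int and y where "s = pure_tensor (of_int a *\<^sub>R u + of_int b *\<^sub>R v) y" "y \<in> L"
      using base by (auto simp: group_closure_insert)
    then show ?case
    proof cases
      case 1
      then show ?thesis
        using is_lattice_zero_diff(1) [OF L] by (intro image_eqI [of _ _ "(0, 0)"]) (auto simp: rzero)
    next
      case 2
      have "of_int k *\<^sub>R y \<in> L" for k
        using group_closure_of_int_scaleR [of y L k] 2 is_lattice_group_closure [OF L] by simp
      then show ?thesis
        using 2 by (intro image_eqI [of _ _ "(of_int a *\<^sub>R y, of_int b *\<^sub>R y)"]) (auto simp: ladd lmul rmul)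
    qed
  next
    case (diff s t)
    then obtain y z y' z' where "s = pure_tensor u y + pure_tensor v z" "t = pure_tensor u y' + pure_tensor v z'"
      "y \<in> L" "z \<in> L" "y' \<in> L" "z' \<in> L"
      by auto
    then show ?case
      by (intro image_eqI [of _ _ "(y - y', z - z')"]) (auto simp: rsub intro: is_lattice_zero_diff(2) [OF L])
  qed
  then show "lattice_tensor (group_closure {u, v}) L \<subseteq> ?R"
    by (auto simp: lattice_tensor_def)
  show "?R \<subseteq> lattice_tensor (group_closure {u, v}) L"
  proof clarify
    fix y z assume "y \<in> L" "z \<in> L"
    moreover have "u \<in> group_closure {u, v}" "v \<in> group_closure {u, v}"
      by (auto intro: group_closure.base)
    ultimately have "pure_tensor u y \<in> ?G" "pure_tensor v z \<in> ?G"
      by blast+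
    then show "pure_tensor u y + pure_tensor v z \<in> lattice_tensor (group_closure {u, v}) L"
      unfolding lattice_tensor_def by (intro group_closure_add group_closure.base insertI2)
  qed
qed

section \<open>Theta sums of tensor products\<close>

lemma rho_image_scaled:
  fixes f :: "'a::real_normed_vector \<Rightarrow> 'b::real_normed_vector"
  assumes f: "linear f" and norm: "\<And>x. norm (f x) = t * norm x" and t: "t > 0"
  shows "rho (f ` L) = rho ((*\<^sub>R) t ` L)"
proof -
  have inj: "inj f"
    unfolding linear_injective_0 [OF f]
  proof (intro allI impI)
    fix x assume "f x = 0"
    then show "x = 0"
      using norm [of x] t by simp
  qed
  show ?thesis
    unfolding rho_def using t norm
    by (subst (1 2) infsum_reindex) (auto intro: inj_on_subset [OF inj] inj_onI simp: o_def)
qed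

lemma rho_pure_tensor_image:
  assumes "q \<noteq> 0"
  shows "rho (pure_tensor q ` L) = rho ((*\<^sub>R) (norm q) ` L)"
  using assms by (intro rho_image_scaled linear_pure_tensor_right norm_pure_tensor) simp

lemma is_lattice_scaled:
  assumes "is_lattice L" "t \<noteq> 0"
  shows "is_lattice ((*\<^sub>R) t ` L)"
proof -
  obtain B where B: "independent B" "group_closure B = L"
    using assms by (auto simp: is_lattice_def)
  have lin: "linear ((*\<^sub>R) t :: 'a \<Rightarrow> 'a)"
    by (rule linear_scale_self)
  have "independent ((*\<^sub>R) t ` B)"
    using assms(2) by (intro linear_independent_injective_image lin B) (auto simp: inj_on_def)
  then show ?thesis
    using group_closure_linear_image [OF lin, of B] B by (auto simp: is_lattice_def)
qed

text \<open>Tensors with \<open>u\<close> are orthogonal to tensors with \<open>v\<close>, so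
  squared norms add and the Gaussian becomes a product in the two coordinates. The same identity
  gives injectivity, as a vanishing sum of squares forces both coordinates to vanish.\<close>

lemma rho_lattice_tensor_orthogonal:
  fixes u v :: "'b::euclidean_space"
  assumes L: "is_lattice L" and uv: "inner u v = 0" "u \<noteq> 0" "v \<noteq> 0"
  shows "rho (lattice_tensor (group_closure {u, v}) L) =
    rho ((*\<^sub>R) (norm u) ` L) * rho ((*\<^sub>R) (norm v) ` L)"
proof -
  let ?h = "\<lambda>(y, z). pure_tensor u y + pure_tensor v z"
  let ?g = "\<lambda>w y. exp (- pi * (norm w * norm y)\<^sup>2)"
  have norm: "(norm (pure_tensor u y + pure_tensor v z))\<^sup>2 = (norm u * norm y)\<^sup>2 + (norm v * norm z)\<^sup>2" for y z
    using norm_add_Pythagorean [of "pure_tensor u y" "pure_tensor v z"] uv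
    by (simp add: real_inner_class.orthogonal_def inner_pure_tensor norm_pure_tensor)
  have inj: "inj_on ?h (L \<times> L)"
  proof (rule inj_onI, clarify)
    fix y z y' z' assume "pure_tensor u y + pure_tensor v z = pure_tensor u y' + pure_tensor v z'"
    then have "pure_tensor u (y - y') + pure_tensor v (z - z') = 0"
      by (simp add: bilinear_rsub [OF bilinear_pure_tensor] algebra_simps)
    then have "(norm u * norm (y - y'))\<^sup>2 + (norm v * norm (z - z'))\<^sup>2 = 0"
      using norm [of "y - y'" "z - z'"] by simp
    then show "y = y' \<and> z = z'"
      using uv by (simp add: sum_power2_eq_zero_iff)
  qed
  have scaled: "(\<lambda>y. ?g w y) summable_on L" "rho ((*\<^sub>R) (norm w) ` L) = infsum (?g w) L"
    if w: "w \<noteq> 0" for w :: 'b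
  proof -
    have inj: "inj_on ((*\<^sub>R) (norm w)) L"
      using w by (auto simp: inj_on_def)
    have eq: "(\<lambda>x. exp (- pi * (norm x)\<^sup>2)) \<circ> (*\<^sub>R) (norm w) = ?g w"
      by (auto simp: fun_eq_iff)
    show "?g w summable_on L"
      using summable_gaussian_lattice [OF is_lattice_scaled [OF L, of "norm w"]] w
      unfolding summable_on_reindex [OF inj] eq by simp
    show "rho ((*\<^sub>R) (norm w) ` L) = infsum (?g w) L"
      unfolding rho_def by (subst infsum_reindex [OF inj]) (simp only: eq)
  qed
  have hs: "((\<lambda>(y, z). ?g u y * ?g v z) has_sum (infsum (?g u) L * infsum (?g v) L)) (L \<times> L)"
  proof (rule has_sum_SigmaI)
    show inner: "((\<lambda>z. case (y, z) of (y, z) \<Rightarrow> ?g u y * ?g v z) has_sum ?g u y * infsum (?g v) L) L" for y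
      using has_sum_cmult_right [OF has_sum_infsum [OF scaled(1) [OF uv(3)]]] by simp
    show outer: "((\<lambda>y. ?g u y * infsum (?g v) L) has_sum (infsum (?g u) L * infsum (?g v) L)) L"
      by (intro has_sum_cmult_left has_sum_infsum scaled(1) uv)
    show "(\<lambda>(y, z). ?g u y * ?g v z) summable_on L \<times> L"
      using inner has_sum_imp_summable [OF outer] by (rule summable_on_SigmaI) auto
  qed
  have eq: "(\<lambda>x. exp (- pi * (norm x)\<^sup>2)) \<circ> ?h = (\<lambda>(y, z). ?g u y * ?g v z)"
    by (auto simp: fun_eq_iff norm algebra_simps simp flip: exp_add)
  have "rho (?h ` (L \<times> L)) = infsum (?g u) L * infsum (?g v) L"
    unfolding rho_def infsum_reindex [OF inj] eq by (rule infsumI [OF hs])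
  then show ?thesis
    unfolding lattice_tensor_two_generators [OF L] scaled(2) [OF uv(2)] scaled(2) [OF uv(3)] .
qed

lemma group_closure_insert_redundant:
  fixes x :: "'a::real_vector"
  assumes "x \<in> group_closure S"
  shows "group_closure (insert x S) = group_closure S"
proof
  show "group_closure (insert x S) \<subseteq> group_closure S"
    using assms by (auto simp: group_closure_insert intro!: group_closure_add group_closure_of_int_scaleR)
qed (auto intro: group_closure_mono [THEN subsetD, rotated])

section \<open>The resolutions\<close>

text \<open>The image \<open>w\<close> of 1 is \<open>u + real n *\<^sub>R v\<close>, and the
  quotient is generated by the component \<open>q\<close> of \<open>v\<close> orthogonal to
  \<open>w\<close>. For \<open>n = 1\<close> the vector \<open>v\<close> would be zero.\<close>

lemma P_lat_quotient:
  assumes n: "n \<ge> 2"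
  defines "s \<equiv> sqrt (1 / real n ^ 2 - 1 / real n ^ 4)"
  obtains u v q :: "real^2" where
    "P_lat n = group_closure {u, v}" "inner u v = 0" "norm u = 1 / real n" "norm v = s" "s > 0"
    "norm (u + real n *\<^sub>R v) = 1"
    "quotient_lattice (P_lat n) (Z_in_P n) = group_closure {q}" "norm q = s / real n"
    "quotient_proj (P_lat n) (Z_in_P n) u = - real n *\<^sub>R q"
    "quotient_proj (P_lat n) (Z_in_P n) v = q"
proof -
  define u v w :: "real^2" where "u = vector [1 / real n, 0]" and "v = vector [0, s]"
    and "w = u + real n *\<^sub>R v"
  have n1: "real n > 1"
    using n by simp
  have s2: "s\<^sup>2 = (1 - 1 / real n ^ 2) / real n ^ 2" and s0: "s > 0"
  proof -
    have "1 / real n ^ 2 - 1 / real n ^ 4 = (1 - 1 / real n ^ 2) / real n ^ 2"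
      using n1 by (simp add: field_simps flip: power_add)
    moreover have "(1 - 1 / real n ^ 2) / real n ^ 2 > 0"
      using n1 by simp
    ultimately show "s\<^sup>2 = (1 - 1 / real n ^ 2) / real n ^ 2" "s > 0"
      by (simp_all add: s_def)
  qed
  \<comment> \<open>This identifies the second coordinate of the embedded generator with that of
    \<open>w\<close>.\<close>
  have ns: "sqrt (1 - 1 / real n ^ 2) = real n * s"
    using s2 s0 n1 by (intro real_sqrt_unique) (auto simp: power_mult_distrib)
  have inner_uv: "inner u u = 1 / real n ^ 2" "inner u v = 0" "inner v u = 0" "inner v v = s\<^sup>2"
    by (simp_all add: u_def v_def inner_vec_def sum_2 power2_eq_square)
  have P: "P_lat n = group_closure {u, v}"
    by (simp add: P_lat_def u_def v_def s_def)
  have "w = vector [1 / real n, real n * s]"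
    by (simp add: w_def u_def v_def Finite_Cartesian_Product.vec_eq_iff forall_2)
  then have Z: "Z_in_P n = range (\<lambda>k::int. real_of_int k *\<^sub>R w)"
    by (simp add: Z_in_P_def ns)
  have "inner w w = 1 / real n ^ 2 + (real n)\<^sup>2 * s\<^sup>2"
    by (simp add: w_def inner_add_left inner_add_right inner_uv power2_eq_square)
  also have "\<dots> = 1"
    using n1 by (simp add: s2)
  finally have ww: "inner w w = 1" .
  have vw: "inner v w = real n * s\<^sup>2"
    by (simp add: w_def inner_add_right inner_uv)
  define q where "q = v - inner v w *\<^sub>R w"
  have wq: "inner w q = 0"
    by (simp add: q_def inner_diff_right ww inner_commute)
  have "inner q q = s\<^sup>2 - (real n * s\<^sup>2)\<^sup>2"
    by (simp add: q_def inner_diff_left inner_diff_right ww inner_uv inner_commute [of w v]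
        flip: vw) (simp add: power2_eq_square)
  \<comment> \<open>The last factor is \<open>1 / real n ^ 2\<close> by \<open>s2\<close>, which
    gives the length of \<open>q\<close>.\<close>
  also have "\<dots> = s\<^sup>2 * (1 - (real n)\<^sup>2 * s\<^sup>2)"
    by (simp add: power2_eq_square algebra_simps)
  also have "\<dots> = (s / real n)\<^sup>2"
    using n1 by (simp add: s2 power_divide)
  finally have norm_q: "norm q = s / real n"
    using s0 n1 by (simp add: norm_eq_sqrt_inner)
  let ?S = "span (P_lat n) \<inter> orthogonal_comp (span (Z_in_P n))"
  define p where "p = quotient_proj (P_lat n) (Z_in_P n)"
  have S: "subspace ?S"
    by (intro subspace_inter subspace_orthogonal_comp subspace_span)
  have "w \<in> span (Z_in_P n)"
    unfolding Z by (intro span_base image_eqI [of _ _ 1]) auto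
  then have S_w: "inner y w = 0" if "y \<in> ?S" for y
    using that by (auto simp: orthogonal_comp_def real_inner_class.orthogonal_def inner_commute)
  have uvP: "u \<in> span (P_lat n)" "v \<in> span (P_lat n)"
    unfolding P span_group_closure by (auto intro: span_base)
  have lin: "linear p"
    unfolding p_def by (rule linear_quotient_proj)
  have pw: "p w = 0"
    unfolding p_def quotient_proj_def
    by (rule orth_proj_eqI [OF S])
      (auto simp: S_w subspace_0 [OF S] orthogonal_comp_def real_inner_class.orthogonal_def
        intro!: S_w span_zero)
  have "orthogonal q y" if "y \<in> span (Z_in_P n)" for y
    using that by (rule orthogonal_to_span)
      (auto simp: Z real_inner_class.orthogonal_def inner_commute [of q w] wq)
  then have "q \<in> orthogonal_comp (span (Z_in_P n))"
    by (auto simp: orthogonal_comp_def orthogonal_commute)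
  moreover have "q \<in> span (P_lat n)"
    unfolding q_def w_def by (intro span_diff span_scale span_add uvP)
  moreover have "v - q \<in> orthogonal_comp ?S"
    using S_w by (auto simp: q_def orthogonal_comp_def real_inner_class.orthogonal_def)
  ultimately have pv: "p v = q"
    unfolding p_def quotient_proj_def by (intro orth_proj_eqI [OF S]) auto
  have "p w = p u + real n *\<^sub>R p v"
    by (simp add: w_def linear_add [OF lin] linear_scale [OF lin])
  \<comment> \<open>The projection kills \<open>w\<close>, so the image of \<open>u\<close> is an
    integer multiple of that of \<open>v\<close>; a single generator therefore suffices for the
    quotient.\<close>
  then have pu: "p u = - real n *\<^sub>R q"
    using pw pv by (simp add: eq_neg_iff_add_eq_0)
  have "quotient_lattice (P_lat n) (Z_in_P n) = p ` P_lat n"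
    by (simp add: quotient_lattice_def p_def)
  also have "\<dots> = group_closure (p ` {u, v})"
    by (simp only: P group_closure_linear_image [OF lin])
  also have "\<dots> = group_closure {- real n *\<^sub>R q, q}"
    by (simp only: image_insert image_empty pu pv)
  also have "\<dots> = group_closure {q}"
    using group_closure_of_int_scaleR [of q "{q}" "- int n"]
    by (intro group_closure_insert_redundant) (auto intro: group_closure.base)
  finally have "quotient_lattice (P_lat n) (Z_in_P n) = group_closure {q}" .
  moreover have "norm u = 1 / real n" "norm v = s" "norm (u + real n *\<^sub>R v) = 1"
    using s0 n1 ww by (simp_all add: norm_eq_sqrt_inner inner_uv real_sqrt_divide flip: w_def)
  ultimately show thesis
    by (rule that [OF P inner_uv(2) _ _ s0 _ _ norm_q pu [unfolded p_def] pv [unfolded p_def], rotated -1])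
qed

text \<open>In the coordinates \<open>(y, z)\<close> of the two-generator form, the map yields the
  tensor of \<open>q\<close> with \<open>z - real n *\<^sub>R y\<close>. The kernel is the graph
  \<open>z = real n *\<^sub>R y\<close>, and \<open>L\<close> is closed under multiplication by
  \<open>n\<close>.\<close>

lemma Ker_tensor_map:
  fixes L :: "'a::euclidean_space set"
  assumes L: "is_lattice L" and lin: "linear p" and q: "p v = q" "p u = - real n *\<^sub>R q" "q \<noteq> 0"
  shows "Ker (lattice_tensor (group_closure {u, v}) L) (tensor_map p (\<lambda>y. y)) =
    pure_tensor (u + real n *\<^sub>R v) ` L"
proof -
  note rsub = bilinear_rsub [OF bilinear_pure_tensor]
    and rmul = bilinear_rmul [OF bilinear_pure_tensor]
    and ladd = bilinear_ladd [OF bilinear_pure_tensor] and lmul = bilinear_lmul [OF bilinear_pure_tensor]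
  have "tensor_map p (\<lambda>y. y) (pure_tensor u y + pure_tensor v z) = pure_tensor q (z - real n *\<^sub>R y)" for y z :: 'a
    using q by (simp add: linear_add [OF linear_tensor_map [OF lin linear_ident]]
        tensor_map_pure_tensor [OF lin linear_ident] rsub rmul lmul
        bilinear_lneg [OF bilinear_pure_tensor])
  moreover have "pure_tensor q z = 0 \<longleftrightarrow> z = 0" for z :: 'a
    using q(3) norm_pure_tensor [of q z] by (metis mult_eq_0_iff norm_eq_zero)
  ultimately have zero: "tensor_map p (\<lambda>y. y) (pure_tensor u y + pure_tensor v z) = 0 \<longleftrightarrow> z = real n *\<^sub>R y"
    for y z :: 'a
    by simp
  have diag: "pure_tensor (u + real n *\<^sub>R v) y = pure_tensor u y + pure_tensor v (real n *\<^sub>R y)" for y :: 'a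
    by (simp add: ladd lmul rmul)
  have "real n *\<^sub>R y \<in> L" if "y \<in> L" for y
    using group_closure_of_int_scaleR [of y L "int n"] that is_lattice_group_closure [OF L] by simp
  then show ?thesis
    unfolding Ker_def lattice_tensor_two_generators [OF L] by (auto simp: zero diag image_iff)
qed

lemma h_complex_R_complex:
  assumes L: "is_lattice L" and n: "n \<ge> 2"
  defines "s \<equiv> sqrt (1 / real n ^ 2 - 1 / real n ^ 4)"
  shows "h_complex 0 (R_complex L n) = ln (rho L)"
    and "h_complex 1 (R_complex L n) = ln (rho L) +
      (ln (rho ((*\<^sub>R) (s / real n) ` L)) - ln (rho ((*\<^sub>R) (1 / real n) ` L) * rho ((*\<^sub>R) s ` L)))"
proof -
  obtain u v q :: "real^2" where
    P: "P_lat n = group_closure {u, v}" "inner u v = 0" "norm u = 1 / real n" "norm v = s" "s > 0"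
    and w: "norm (u + real n *\<^sub>R v) = 1"
    and Q: "quotient_lattice (P_lat n) (Z_in_P n) = group_closure {q}" "norm q = s / real n"
    and proj: "quotient_proj (P_lat n) (Z_in_P n) u = - real n *\<^sub>R q"
      "quotient_proj (P_lat n) (Z_in_P n) v = q"
    using P_lat_quotient [OF n] unfolding s_def by metis
  have "u \<noteq> 0" "v \<noteq> 0" "q \<noteq> 0" and w0: "u + real n *\<^sub>R v \<noteq> 0"
    using P Q w n by auto
  have "rho (Ker (lattice_tensor (P_lat n) L) (tensor_map (quotient_proj (P_lat n) (Z_in_P n)) (\<lambda>y. y))) = rho L"
    unfolding Ker_tensor_map [OF L linear_quotient_proj proj(2,1) \<open>q \<noteq> 0\<close>, folded P(1)]
    using rho_pure_tensor_image [OF w0, of L] w by simp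
  then have nul1: "nul (lattice_tensor (P_lat n) L) (tensor_map (quotient_proj (P_lat n) (Z_in_P n)) (\<lambda>y. y)) = ln (rho L)"
    by (simp add: nul_def ell_def)
  have "ell (lattice_tensor (P_lat n) L) = ln (rho ((*\<^sub>R) (1 / real n) ` L) * rho ((*\<^sub>R) s ` L))"
    using rho_lattice_tensor_orthogonal [OF L P(2) \<open>u \<noteq> 0\<close> \<open>v \<noteq> 0\<close>] P by (simp add: ell_def)
  moreover have "ell (lattice_tensor (quotient_lattice (P_lat n) (Z_in_P n)) L) = ln (rho ((*\<^sub>R) (s / real n) ` L))"
    using rho_pure_tensor_image [OF \<open>q \<noteq> 0\<close>, of L] Q
    by (simp add: ell_def lattice_tensor_cyclic [OF L])
  \<comment> \<open>The map out of the second lattice is zero, so its nullity is the whole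
    \<open>ell\<close>; likewise the zero map out of the zeroth lattice has rank 0. Thus degree 1 is
    \<open>ell\<close> of the second lattice minus \<open>ell\<close> of the first plus the nullity
    of the projection.\<close>
  moreover have "nul A (\<lambda>_. 0 :: (real^2, 'a) tensor) = ell A" for A :: "(real^2, 'a) tensor set"
    by (simp add: nul_def Ker_def)
  ultimately show "h_complex 0 (R_complex L n) = ln (rho L)"
    and "h_complex 1 (R_complex L n) = ln (rho L) +
      (ln (rho ((*\<^sub>R) (s / real n) ` L)) - ln (rho ((*\<^sub>R) (1 / real n) ` L) * rho ((*\<^sub>R) s ` L)))"
    using nul1 by (simp_all add: h_complex_def R_complex_def rk_def numeral_2_eq_2)
qed

text \<open>Zero maps have rank 0, and from index 3 on the lattices are \<open>{0}\<close>, whose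
  \<open>rho\<close> is 1.\<close>

lemma h_complex_R_complex_higher:
  assumes "k \<ge> 2"
  shows "h_complex k (R_complex L n) = 0"
  using assms by (simp add: h_complex_def R_complex_def rk_def nul_def Ker_def ell_def rho_def)

section \<open>Passage to the limit\<close>

lemma tendsto_h_complex_1:
  assumes L: "is_lattice L"
  shows "(\<lambda>n. h_complex 1 (R_complex L n)) \<longlonglongrightarrow> ln (rho L) + ln (vol L)"
proof -
  define s where "s n = sqrt (1 / real n ^ 2 - 1 / real n ^ 4)" for n
  define r where "r t = rho ((*\<^sub>R) t ` L)" for t
  obtain d where d: "((\<lambda>t. vol L * t ^ d * r t) \<longlongrightarrow> 1) (at_right 0)"
    using tendsto_vol_rho_scaled [OF L] unfolding r_def .
  have vol: "vol L > 0"
    by (rule vol_pos [OF L])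
  have r: "r t > 0" if "t > 0" for t
    using rho_ge_1 [OF is_lattice_scaled [OF L, of t]] that by (simp add: r_def)
  have "filterlim s (at_right 0) sequentially" "filterlim (\<lambda>n. 1 / real n) (at_right 0) sequentially"
    "filterlim (\<lambda>n. s n / real n) (at_right 0) sequentially"
    unfolding s_def by real_asymp+
  note lims = this [THEN filterlim_compose [OF d]]
  have s: "s n > 0" if "n \<ge> 2" for n
    using P_lat_quotient [OF that] unfolding s_def by metis
  \<comment> \<open>Each of the three normalised theta sums tends to 1. The powers with exponent
    \<open>d\<close> cancel since \<open>s n / real n\<close> is the product of the other two
    scales; one volume above and two below leave \<open>1 / vol L\<close>, which the leading factor
    removes.\<close>
  have "(\<lambda>n. vol L * ((vol L * (s n / real n) ^ d * r (s n / real n)) /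
      ((vol L * (1 / real n) ^ d * r (1 / real n)) * (vol L * s n ^ d * r (s n))))) \<longlonglongrightarrow> vol L * (1 / (1 * 1))"
    by (intro tendsto_intros lims) simp
  moreover have "\<forall>\<^sub>F n in sequentially. vol L * ((vol L * (s n / real n) ^ d * r (s n / real n)) /
      ((vol L * (1 / real n) ^ d * r (1 / real n)) * (vol L * s n ^ d * r (s n)))) =
      r (s n / real n) / (r (1 / real n) * r (s n))"
    using eventually_ge_at_top [of 2]
  proof eventually_elim
    case (elim n)
    then show ?case
      using vol s [of n] by (simp add: field_simps)
  qed
  ultimately have "(\<lambda>n. r (s n / real n) / (r (1 / real n) * r (s n))) \<longlonglongrightarrow> vol L"
    by (simp add: tendsto_cong)
  then have "(\<lambda>n. ln (rho L) + ln (r (s n / real n) / (r (1 / real n) * r (s n)))) \<longlonglongrightarrow> ln (rho L) + ln (vol L)"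
    using vol by (intro tendsto_intros) auto
  moreover have "\<forall>\<^sub>F n in sequentially. ln (rho L) + ln (r (s n / real n) / (r (1 / real n) * r (s n))) =
      h_complex 1 (R_complex L n)"
    using eventually_ge_at_top [of 2]
  proof eventually_elim
    case (elim n)
    then have "r (s n / real n) > 0" "r (1 / real n) * r (s n) > 0"
      using s [of n] by (simp_all add: r)
    then show ?case
      unfolding h_complex_R_complex(2) [OF L elim] r_def s_def by (subst ln_div) auto
  qed
  ultimately show ?thesis
    by (rule Lim_transform_eventually)
qed

theorem theorem11p5:
  fixes L :: "'a::euclidean_space set"
  assumes "is_lattice L"
  shows "(\<forall>k. convergent (\<lambda>n. h_complex k (R_complex L n))) \<and>
         lattice_h 0 L = ln (rho L) \<and>
         lattice_h 1 L = ln (rho L) + ln (vol L) \<and>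
         (\<forall>k\<ge>2. lattice_h k L = 0) \<and>
         euler_char L = - ln (vol L)"
proof -
  \<comment> \<open>The sequence is constant from \<open>n = 2\<close> on, so the degenerate values
    at 0 and 1 do not matter.\<close>
  have 0: "(\<lambda>n. h_complex 0 (R_complex L n)) \<longlonglongrightarrow> ln (rho L)"
    by (intro tendsto_eventually eventually_mono [OF eventually_ge_at_top [of 2]]
        h_complex_R_complex(1) [OF assms])
  note 1 = tendsto_h_complex_1 [OF assms]
  have 2: "(\<lambda>n. h_complex k (R_complex L n)) \<longlonglongrightarrow> 0" if "k \<ge> 2" for k
    by (simp add: h_complex_R_complex_higher that)
  have "convergent (\<lambda>n. h_complex k (R_complex L n))" for k
  proof -
    consider "k = 0" | "k = 1" | "k \<ge> 2"
      by linarith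
    then show ?thesis
      using 0 1 2 [of k] by cases (auto simp: convergent_def)
  qed
  then show ?thesis
    using limI [OF 0] limI [OF 1] limI [OF 2] by (simp add: lattice_h_def euler_char_def)
qed

end
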